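(* Let $f:\mathbb{R}^n\times\mathbb{R}^m\to\mathbb{R}$ and $g:\mathbb{R}^m\to\mathbb{R}^p$ be twice continuously differentiable, $Y:=\{y\in\mathbb{R}^m\mid g(y)\le0\}$, $\varphi(x):=\min_{y\in Y}f(x,y)$ and $S(x):=\arg\min_{y\in Y}f(x,y)$, with $S(x)\ne\emptyset$ for all $x\in\mathbb{R}^n$. Let $Y$ be compact. Let $(\bar x,\underline{x})$ be such that $\underline{x}\in\partial\varphi(\bar x)$ and such that for all $(a,z)\in\Gamma^\circ(\bar x,\underline{x})$ the implication $$\Big[\sum_{s=1}^{n+1}v^s=0,\ \ v^s\in\bigcup_{y\in\Delta^\circ(\bar x,z^s)}D^*S(\bar x|y)(0),\ s=1,\dots,n+1\Big]\Longrightarrow v^1=\dots=v^{n+1}=0$$ holds. Then for all $\underline{x}^*\in\mathbb{R}^n$, $$\partial^2\varphi(\bar x|\underline{x})(\underline{x}^* )\subseteq\bigcup_{(a,z)\in\Gamma^\circ(\bar x,\underline{x})}\left\{\sum_{s=1}^{n+1}\left[\bigcup_{y\in\Delta^\circ(\bar x,z^s)}\Big[a_s\nabla^2_{xx}f(\bar x,y)\underline{x}^*+D^*S(\bar x|y)\big(a_s\nabla^2_{xy}f(\bar x,y)\underline{x}^*\big)\Big]\right]\right\}.$$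
   Context: Definitions. $$\Gamma^\circ(\bar x,\underline{x}):=\Big\{(a,z)\in\mathbb{R}^{n+1}\times\prod_{s=1}^{n+1}\mathbb{R}^m\ \Big|\ a\ge0,\ \sum_{s=1}^{n+1}a_s=1,\ \sum_{s=1}^{n+1}a_s\nabla_xf(\bar x,z^s)=\underline{x},\ z=(z^s)_{s=1}^{n+1}\in\prod_{s=1}^{n+1}S(\bar x)\Big\},$$ $$\Delta^\circ(\bar x,z^s):=\{y\in S(\bar x)\mid\nabla_xf(\bar x,y)=\nabla_xf(\bar x,z^s)\}.$$ $\nabla^2_{xx}f$ is the $n\times n$ Hessian in $x$; $\nabla^2_{xy}f$ is the $m\times n$ matrix with entries $\partial^2f/\partial y_i\partial x_j$. Sums and unions of sets are Minkowski sums and ordinary unions. Normal cone. For closed $C\subseteq\mathbb{R}^d$ and $\bar z\in C$, $\widehat N_C(\bar z):=\{v\mid \langle v,z-\bar z\rangle\le o(\|z-\bar z\|)\ \forall z\in C\}$, and $N_C(\bar z):=\{v\mid\exists v_k\to v,\ z_k\to\bar z,\ z_k\in C,\ v_k\in\widehat N_C(z_k)\}$ (Mordukhovich normal cone). Coderivative: $D^*\Psi(\bar x|\bar y)(y^* ):=\{x^*\mid(x^*,-y^* )\in N_{\mathrm{gph}\,\Psi}(\bar x,\bar y)\}$. $\partial\varphi$ is the Clarke subdifferential of $\varphi$, and $\partial^2\varphi(\bar x|\underline{x})(\underline{x}^* ):=D^*(\partial\varphi)(\bar x|\underline{x})(\underline{x}^* )$ for $\underline{x}\in\partial\varphi(\bar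 x)$. *)

theory Defs
  imports "HOL-Analysis.Analysis" "HOL-Library.Set_Algebras"
begin

section \<open>Twice continuously differentiable maps and partial derivatives\<close>

definition twice_continuously_differentiable ::
    "('a::real_normed_vector \<Rightarrow> 'b::real_normed_vector) \<Rightarrow> bool" where
  "twice_continuously_differentiable h \<longleftrightarrow>
     (\<exists>(h' :: 'a \<Rightarrow> 'a \<Rightarrow>\<^sub>L 'b) (h'' :: 'a \<Rightarrow> 'a \<Rightarrow>\<^sub>L 'a \<Rightarrow>\<^sub>L 'b).
        (\<forall>u. (h has_derivative blinfun_apply (h' u)) (at u)) \<and>
        (\<forall>u. (h' has_derivative blinfun_apply (h'' u)) (at u)) \<and>
        continuous_on UNIV h'')"

definition partial_derivative :: "'k::finite \<Rightarrow> (real^'k \<Rightarrow> real) \<Rightarrow> real^'k \<Rightarrow> real" where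
  "partial_derivative i h u = deriv (\<lambda>t. h (u + t *\<^sub>R axis i 1)) 0"

definition grad_x :: "((real^'n) \<times> (real^'m) \<Rightarrow> real) \<Rightarrow> real^'n \<Rightarrow> real^'m \<Rightarrow> real^'n" where
  "grad_x f x y = (\<chi> j. partial_derivative j (\<lambda>u. f (u, y)) x)"

definition hess_xx :: "((real^'n) \<times> (real^'m) \<Rightarrow> real) \<Rightarrow> real^'n \<Rightarrow> real^'m \<Rightarrow> real^'n^'n" where
  "hess_xx f x y = (\<chi> i j. partial_derivative i (\<lambda>u. grad_x f u y $ j) x)"

text \<open>The \<open>m \<times> n\<close> matrix whose entry in row \<open>i\<close> and column \<open>j\<close> is
  \<open>\<partial>\<^sup>2f / \<partial>y\<^sub>i \<partial>x\<^sub>j\<close>.\<close>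

definition hess_xy :: "((real^'n) \<times> (real^'m) \<Rightarrow> real) \<Rightarrow> real^'n \<Rightarrow> real^'m \<Rightarrow> real^'n^'m" where
  "hess_xy f x y = (\<chi> i j. partial_derivative i (\<lambda>w. grad_x f x w $ j) y)"


section \<open>Normal cones, coderivatives and the Clarke subdifferential\<close>

text \<open>The condition \<open>\<langle>v, z' - z\<rangle> \<le> o(\<parallel>z' - z\<parallel>)\<close> for \<open>z' \<in> C\<close> is one-sided and is spelled out
  with an \<open>\<epsilon>\<close>. Base points outside \<open>C\<close> play no role:
  the limiting normal cone evaluates regular normals at points of \<open>C\<close> only.\<close>

definition regular_normal_cone :: "'a::euclidean_space set \<Rightarrow> 'a \<Rightarrow> 'a set" where
  "regular_normal_cone C z =
     {v. \<forall>\<epsilon>>0. \<forall>\<^sub>F z' in at z within C. v \<bullet> (z' - z) \<le> \<epsilon> * norm (z' - z)}"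

definition limiting_normal_cone :: "'a::euclidean_space set \<Rightarrow> 'a \<Rightarrow> 'a set" where
  "limiting_normal_cone C z =
     {v. \<exists>(vs :: nat \<Rightarrow> 'a) zs. vs \<longlonglongrightarrow> v \<and> zs \<longlonglongrightarrow> z \<and>
           (\<forall>k. zs k \<in> C \<and> vs k \<in> regular_normal_cone C (zs k))}"

definition graph_of :: "('a \<Rightarrow> 'b set) \<Rightarrow> ('a \<times> 'b) set" where
  "graph_of \<Psi> = {(x, y). y \<in> \<Psi> x}"

definition coderivative ::
    "('a::euclidean_space \<Rightarrow> 'b::euclidean_space set) \<Rightarrow> 'a \<Rightarrow> 'b \<Rightarrow> 'b \<Rightarrow> 'a set" where
  "coderivative \<Psi> x y ys = {xs. (xs, - ys) \<in> limiting_normal_cone (graph_of \<Psi>) (x, y)}"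

text \<open>The Clarke subdifferential is given by the generalized directional derivative, as
  appropriate for locally Lipschitz functions: the upper limit is over base points
  \<open>x' \<rightarrow> x\<close> (with \<open>x' = x\<close> allowed) and step sizes \<open>t \<down> 0\<close>.\<close>

definition clarke_dir_deriv :: "('a::euclidean_space \<Rightarrow> real) \<Rightarrow> 'a \<Rightarrow> 'a \<Rightarrow> ereal" where
  "clarke_dir_deriv \<phi> x d =
     Limsup (nhds x \<times>\<^sub>F at_right 0) (\<lambda>(x', t). ereal ((\<phi> (x' + t *\<^sub>R d) - \<phi> x') / t))"

definition clarke_subdifferential :: "('a::euclidean_space \<Rightarrow> real) \<Rightarrow> 'a \<Rightarrow> 'a set" where
  "clarke_subdifferential \<phi> x = {v. \<forall>d. ereal (v \<bullet> d) \<le> clarke_dir_deriv \<phi> x d}"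

definition second_subdifferential ::
    "('a::euclidean_space \<Rightarrow> real) \<Rightarrow> 'a \<Rightarrow> 'a \<Rightarrow> 'a \<Rightarrow> 'a set" where
  "second_subdifferential \<phi> x xl xs = coderivative (clarke_subdifferential \<phi>) x xl xs"


section \<open>The parametric optimization problem\<close>

definition feasible_set :: "(real^'m \<Rightarrow> real^'p) \<Rightarrow> (real^'m) set" where
  "feasible_set g = {y. g y \<le> 0}"

text \<open>The infimum is a minimum wherever \<open>solution_map f g x\<close> is nonempty.\<close>

definition optimal_value ::
    "((real^'n) \<times> (real^'m) \<Rightarrow> real) \<Rightarrow> (real^'m \<Rightarrow> real^'p) \<Rightarrow> real^'n \<Rightarrow> real" where
  "optimal_value f g x = (INF y\<in>feasible_set g. f (x, y))"

definition solution_map ::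
    "((real^'n) \<times> (real^'m) \<Rightarrow> real) \<Rightarrow> (real^'m \<Rightarrow> real^'p) \<Rightarrow> real^'n \<Rightarrow> (real^'m) set" where
  "solution_map f g x = {y. is_arg_min (\<lambda>y. f (x, y)) (\<lambda>y. y \<in> feasible_set g) y}"

text \<open>Families indexed by \<open>s = 1, \<dots>, n + 1\<close> are vectors over the index type \<open>'n option\<close>,
  which has exactly \<open>n + 1\<close> elements when \<open>n = CARD('n)\<close>.\<close>

definition Gamma_circ ::
    "((real^'n) \<times> (real^'m) \<Rightarrow> real) \<Rightarrow> (real^'m \<Rightarrow> real^'p) \<Rightarrow> real^'n \<Rightarrow> real^'n \<Rightarrow>
       ((real^('n option)) \<times> ((real^'m)^('n option))) set" where
  "Gamma_circ f g x xl =
     {(a, z). 0 \<le> a \<and> (\<Sum>s\<in>UNIV. a $ s) = 1 \<and>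
              (\<Sum>s\<in>UNIV. a $ s *\<^sub>R grad_x f x (z $ s)) = xl \<and>
              (\<forall>s. z $ s \<in> solution_map f g x)}"

definition Delta_circ ::
    "((real^'n) \<times> (real^'m) \<Rightarrow> real) \<Rightarrow> (real^'m \<Rightarrow> real^'p) \<Rightarrow> real^'n \<Rightarrow> real^'m \<Rightarrow>
       (real^'m) set" where
  "Delta_circ f g x zs = {y \<in> solution_map f g x. grad_x f x y = grad_x f x zs}"

end

theory Submission
  imports Defs
begin

text \<open>By Danskin's theorem \<open>\<partial>\<phi>(u)\<close> is the convex hull of the gradients \<open>\<nabla>\<^sub>xf(u, y)\<close> with
  \<open>y \<in> S(u)\<close>, so by Caratheodory its elements are the convex combinations described by
  \<open>\<Gamma>\<^sup>\<circ>\<close>. A regular normal to the graph of \<open>\<partial>\<phi>\<close> at such a point is pulled back along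
  \<open>(u, y) \<mapsto> (u, \<Sum>\<^sub>s a\<^sub>s \<nabla>\<^sub>xf(u, y\<^sub>s))\<close> to a regular normal to
  \<open>{(u, y). \<forall>s. y\<^sub>s \<in> S(u)}\<close>. Compactness lets one pass to the limit in \<open>(a, y)\<close>, and the
  intersection rule for limiting normals, whose qualification condition is the hypothesis with
  \<open>y = z\<^sup>s\<close>, splits the limit into one coderivative of \<open>S\<close> for each \<open>s\<close>. In particular the choice
  \<open>y = z\<^sup>s\<close> in \<open>\<Delta>\<^sup>\<circ>(x, z\<^sup>s)\<close> always suffices.\<close>

section \<open>Normal cones\<close>

text \<open>The filter \<open>at z within C\<close> omits \<open>z\<close> itself. At
  \<open>z' = z\<close> both sides vanish, so the base point can be included and later estimates
  need no case distinction.\<close>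

lemma regular_normal_cone_iff:
  "v \<in> regular_normal_cone C z \<longleftrightarrow>
     (\<forall>e>0. \<exists>d>0. \<forall>z'\<in>C. dist z' z < d \<longrightarrow> v \<bullet> (z' - z) \<le> e * norm (z' - z))"
  unfolding regular_normal_cone_def eventually_at mem_Collect_eq
  by (metis cancel_comm_monoid_add_class.diff_cancel inner_zero_right mult_zero_right norm_zero
      order_refl)

text \<open>Proximal normals are regular: the quadratic bound drops below
  \<open>e * norm (z' - z)\<close> as soon as the distance is less than
  \<open>e / (\<bar>c\<bar> + 1)\<close>.\<close>

lemma proximal_imp_regular_normal:
  assumes "\<And>z'. z' \<in> C \<Longrightarrow> v \<bullet> (z' - z) \<le> c * (norm (z' - z))\<^sup>2"
  shows "v \<in> regular_normal_cone C z"
  unfolding regular_normal_cone_iff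
proof (intro allI impI)
  fix e :: real assume e: "e > 0"
  define d where "d = e / (\<bar>c\<bar> + 1)"
  have d: "d > 0" using e by (simp add: d_def)
  moreover have "v \<bullet> (z' - z) \<le> e * norm (z' - z)" if "z' \<in> C" "dist z' z < d" for z'
  proof -
    have "v \<bullet> (z' - z) \<le> c * (norm (z' - z))\<^sup>2" using assms that by blast
    also have "\<dots> \<le> (\<bar>c\<bar> + 1) * (norm (z' - z))\<^sup>2" by (intro mult_right_mono) auto
    also have "\<dots> = (\<bar>c\<bar> + 1) * norm (z' - z) * norm (z' - z)" by (simp add: power2_eq_square)
    also have "\<dots> \<le> (\<bar>c\<bar> + 1) * d * norm (z' - z)"
      using that(2) by (intro mult_right_mono mult_left_mono) (auto simp: dist_norm)
    also have "\<dots> = e * norm (z' - z)" by (simp add: d_def add_nonneg_pos)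
    finally show ?thesis .
  qed
  ultimately show "\<exists>d>0. \<forall>z'\<in>C. dist z' z < d \<longrightarrow> v \<bullet> (z' - z) \<le> e * norm (z' - z)" by blast
qed

lemma regular_normal_cone_scaleR:
  assumes "v \<in> regular_normal_cone C z" "t > 0"
  shows "t *\<^sub>R v \<in> regular_normal_cone C z"
  unfolding regular_normal_cone_iff
proof (intro allI impI)
  fix e :: real assume "e > 0"
  then obtain d where "d > 0" and d: "\<forall>z'\<in>C. dist z' z < d \<longrightarrow> v \<bullet> (z' - z) \<le> e / t * norm (z' - z)"
    using assms unfolding regular_normal_cone_iff by (meson divide_pos_pos)
  then show "\<exists>d>0. \<forall>z'\<in>C. dist z' z < d \<longrightarrow> (t *\<^sub>R v) \<bullet> (z' - z) \<le> e * norm (z' - z)"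
    using assms(2) by (intro exI[of _ d]) (auto simp: field_simps)
qed

text \<open>The first-order expansion of \<open>G\<close> at \<open>z\<close> transfers the
  inequality at \<open>G z\<close> to \<open>z\<close>; \<open>v'\<close> is the adjoint of
  \<open>G'\<close> applied to \<open>v\<close>. The set \<open>C\<close> may be smaller than the
  preimage of \<open>D\<close>, since the inequality is tested only at points of
  \<open>C\<close>.\<close>

lemma regular_normal_cone_pullback:
  fixes G :: "'a::euclidean_space \<Rightarrow> 'b::euclidean_space"
  assumes v: "v \<in> regular_normal_cone D (G z)"
    and sub: "G ` C \<subseteq> D"
    and der: "(G has_derivative G') (at z)"
    and adj: "\<And>h. v' \<bullet> h = v \<bullet> G' h"
  shows "v' \<in> regular_normal_cone C z"
  unfolding regular_normal_cone_iff
proof (intro allI impI)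
  fix e :: real assume e: "e > 0"
  have bl: "bounded_linear G'" using der by (rule has_derivative_bounded_linear)
  then obtain K where K: "\<And>h. norm (G' h) \<le> norm h * K" and K0: "K > 0"
    using bounded_linear.pos_bounded by blast
  \<comment> \<open>Each of the two error sources gets \<open>e / 2\<close>: \<open>e1\<close>
    offsets the growth factor \<open>K + 1\<close> of \<open>G\<close>, and \<open>e2\<close> bounds
    the linearisation error paired with \<open>v\<close>. The cap 1 in \<open>e2\<close> is what
    produces that factor \<open>K + 1\<close>.\<close>
  define e1 where "e1 = e / (2 * (K + 1))"
  define e2 where "e2 = min 1 (e / (2 * (norm v + 1)))"
  have e1: "e1 > 0" and e2: "e2 > 0" using e K0 by (auto simp: e1_def e2_def add_nonneg_pos)
  obtain d1 where d1: "d1 > 0" and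
    v1: "\<And>w. w \<in> D \<Longrightarrow> dist w (G z) < d1 \<Longrightarrow> v \<bullet> (w - G z) \<le> e1 * norm (w - G z)"
    using v e1 unfolding regular_normal_cone_iff by blast
  obtain d2 where d2: "d2 > 0" and
    v2: "\<And>z'. norm (z' - z) < d2 \<Longrightarrow> norm (G z' - G z - G' (z' - z)) \<le> e2 * norm (z' - z)"
    using der e2 unfolding has_derivative_at_alt by blast
  define d where "d = min d2 (d1 / (K + 1))"
  have "d > 0" using d1 d2 K0 by (simp add: d_def)
  moreover have "v' \<bullet> (z' - z) \<le> e * norm (z' - z)" if z': "z' \<in> C" "dist z' z < d" for z'
  proof -
    let ?h = "z' - z"
    have h: "norm ?h < d2" "norm ?h < d1 / (K + 1)" using z' by (auto simp: d_def dist_norm)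
    have R: "norm (G z' - G z - G' ?h) \<le> e2 * norm ?h" using v2 h by blast
    have "norm (G z' - G z) \<le> norm (G z' - G z - G' ?h) + norm (G' ?h)"
      using norm_triangle_ineq[of "G z' - G z - G' ?h" "G' ?h"] by simp
    also have "\<dots> \<le> 1 * norm ?h + norm ?h * K"
      using R K[of ?h] mult_right_mono[of e2 1 "norm ?h"] by (simp add: e2_def)
    finally have L: "norm (G z' - G z) \<le> (K + 1) * norm ?h" by (simp add: algebra_simps)
    have "(K + 1) * norm ?h < d1" using h(2) K0 by (simp add: field_simps)
    then have "v \<bullet> (G z' - G z) \<le> e1 * norm (G z' - G z)"
      using L v1[of "G z'"] sub z' by (auto simp: dist_norm)
    also have "\<dots> \<le> e1 * ((K + 1) * norm ?h)" using L e1 by simp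
    also have "\<dots> = e / 2 * norm ?h" using K0 by (simp add: e1_def field_simps)
    finally have A: "v \<bullet> (G z' - G z) \<le> e / 2 * norm ?h" .
    have "v \<bullet> G' ?h - v \<bullet> (G z' - G z) = - (v \<bullet> (G z' - G z - G' ?h))"
      by (simp add: inner_diff_right)
    also have "\<dots> \<le> norm v * norm (G z' - G z - G' ?h)"
      using Cauchy_Schwarz_ineq2[of v "G z' - G z - G' ?h"] by linarith
    also have "\<dots> \<le> norm v * (e2 * norm ?h)" using R by (intro mult_left_mono) auto
    also have "\<dots> \<le> norm v * (e / (2 * (norm v + 1)) * norm ?h)"
      by (intro mult_left_mono mult_right_mono) (auto simp: e2_def)
    also have "\<dots> = (norm v / (norm v + 1)) * (e / 2 * norm ?h)" by simp
    also have "\<dots> \<le> 1 * (e / 2 * norm ?h)"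
      using e by (intro mult_right_mono) (auto simp: divide_simps add_nonneg_pos)
    finally have "v \<bullet> G' ?h \<le> e / 2 * norm ?h + e / 2 * norm ?h" using A by simp
    then show ?thesis using adj[of ?h] by (simp add: algebra_simps)
  qed
  ultimately show "\<exists>d>0. \<forall>z'\<in>C. dist z' z < d \<longrightarrow> v' \<bullet> (z' - z) \<le> e * norm (z' - z)" by blast
qed

section \<open>Inequalities satisfied by metric projections\<close>

lemma closest_point_proximal:
  fixes a c w :: "'a::real_inner"
  assumes "dist a c \<le> dist a (c + w)"
  shows "(a - c) \<bullet> w \<le> (norm w)\<^sup>2 / 2"
proof -
  have "(norm (a - c))\<^sup>2 \<le> (norm ((a - c) - w))\<^sup>2"
    using assms by (intro power_mono) (auto simp: dist_norm algebra_simps)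
  then show ?thesis
    by (simp add: power2_norm_eq_inner inner_diff_left inner_diff_right inner_commute)
qed

text \<open>The linear side scales with \<open>\<tau>\<close> and the quadratic side with its
  square, so short steps leave only the sign of the inner product. It is meant for directions in
  which a whole ray is feasible.\<close>

lemma inner_nonpos_if_small_steps:
  fixes b w :: "'a::real_inner"
  assumes "\<And>\<tau>. \<tau> > 0 \<Longrightarrow> b \<bullet> (\<tau> *\<^sub>R w) \<le> (norm (\<tau> *\<^sub>R w))\<^sup>2 / 2"
  shows "b \<bullet> w \<le> 0"
proof (rule ccontr)
  assume "\<not> ?thesis"
  then have pos: "b \<bullet> w > 0" by simp
  then have w: "(norm w)\<^sup>2 > 0" by auto
  define \<tau> where "\<tau> = b \<bullet> w / (norm w)\<^sup>2"
  have "\<tau> > 0" using pos w by (simp add: \<tau>_def)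
  with assms[of \<tau>] have "b \<bullet> w \<le> \<tau> * (norm w)\<^sup>2 / 2"
    by (simp add: power_mult_distrib power2_eq_square field_simps)
  also have "\<dots> = b \<bullet> w / 2" using w by (simp add: \<tau>_def)
  finally show False using pos by simp
qed

text \<open>Geometrically, \<open>D\<close> lies in the ball about \<open>P\<close> whose boundary
  passes through the origin; expanding the square gives the inner product form.\<close>

lemma norm_diff_le_imp_inner:
  fixes P D :: "'a::real_inner"
  assumes "norm (P - D) \<le> norm P"
  shows "norm D * norm D \<le> 2 * (P \<bullet> D)"
proof -
  have "(P - D) \<bullet> (P - D) \<le> P \<bullet> P" using assms by (simp add: norm_le)
  moreover have "(P - D) \<bullet> (P - D) = P \<bullet> P - 2 * (P \<bullet> D) + D \<bullet> D"
    by (simp add: inner_diff_left inner_diff_right inner_commute[of D P])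
  ultimately show ?thesis by (simp add: power2_eq_square[symmetric] power2_norm_eq_inner)
qed

section \<open>The intersection rule for normals, first approximately and then in the limit\<close>

text \<open>The fibre product of copies of \<open>M\<close> over the first coordinate, that is, an
  intersection of one preimage of \<open>M\<close> for each \<open>s\<close>, in which the factors
  are coupled only through \<open>x\<close>.\<close>

definition fibre_power :: "('a \<times> 'b) set \<Rightarrow> ('a \<times> ('b^'s)) set" where
  "fibre_power M = {(x, y). \<forall>s. (x, y $ s) \<in> M}"

text \<open>A regular normal to the intersection is first approximated by a proximal normal, and the
  projection defining the latter is relaxed by giving every factor of the intersection its own
  copy \<open>x' + r u\<^sub>s\<close> of the common variable \<open>x'\<close>; the scaling \<open>r \<rightarrow> 0\<close> acts as a quadratic penalty.\<close>

lemma regular_normal_fibre_power_fuzzy: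
  fixes M :: "('a::euclidean_space \<times> 'b::euclidean_space) set" and z q :: "'b^'s"
  assumes M: "closed M" and xz: "(x, z) \<in> fibre_power M"
    and pq: "(p, q) \<in> regular_normal_cone (fibre_power M) (x, z)" and e: "e > 0"
  obtains X :: "'a^'s" and Y :: "'b^'s" and U :: "'a^'s" and V :: "'b^'s"
    where "\<And>s. (X $ s, Y $ s) \<in> M"
      "\<And>s. (U $ s, V $ s) \<in> regular_normal_cone M (X $ s, Y $ s)"
      "\<And>s. dist (X $ s) x < e" "dist Y z < e"
      "dist (\<Sum>s\<in>UNIV. U $ s) p < e" "dist V q < e"
proof -
  define N where "N = norm (p, q)"
  define e3 where "e3 = e / 3"
  have e3: "e3 > 0" using e by (simp add: e3_def)
  obtain d where d: "d > 0" and dn: "\<And>w. w \<in> fibre_power M \<Longrightarrow> dist w (x, z) < d \<Longrightarrow>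
      (p, q) \<bullet> (w - (x, z)) \<le> e3 * norm (w - (x, z))"
    using pq e3 unfolding regular_normal_cone_iff by blast
  \<comment> \<open>The length of the step along \<open>(p, q)\<close>. The second bound keeps all
    points within \<open>2 * t * N\<close> of \<open>(x, z)\<close> inside the radius
    \<open>d\<close> on which \<open>dn\<close> applies; the bound 1/2 later turns
    \<open>t * e\<close> into at most \<open>e / 2\<close>.\<close>
  define t where "t = min (1/2) (d / (3 * (N + 1)))"
  have N0: "N \<ge> 0" by (simp add: N_def)
  have t: "t > 0" using d N0 by (simp add: t_def add_nonneg_pos)
  have tN: "2 * t * N < d"
  proof -
    have "t * (3 * (N + 1)) \<le> d / (3 * (N + 1)) * (3 * (N + 1))"
      using N0 by (intro mult_right_mono) (auto simp: t_def)
    then have "t * (3 * (N + 1)) \<le> d" using N0 by (simp add: add_nonneg_eq_0_iff)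
    moreover have "t * (2 * N) < t * (3 * (N + 1))" using t N0 by (intro mult_strict_left_mono) auto
    ultimately show ?thesis by simp
  qed
  have t1: "t \<le> 1/2" unfolding t_def by (rule min.cobounded1)
  define r where "r j = 1 / real (Suc j)" for j
  have r: "r j > 0" for j by (simp add: r_def)
  define C where "C j = {(x', u::'a^'s, y::'b^'s). \<forall>s. (x' + r j *\<^sub>R u $ s, y $ s) \<in> M}" for j
  have Ceq: "C j = (\<Inter>s. (\<lambda>w. (fst w + r j *\<^sub>R fst (snd w) $ s, snd (snd w) $ s)) -` M)" for j
    by (auto simp: C_def)
  have cont: "continuous_on UNIV (\<lambda>w :: 'a \<times> ('a^'s) \<times> ('b^'s).
      (fst w + r j *\<^sub>R fst (snd w) $ s, snd (snd w) $ s))" for j s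
    by (intro continuous_on_Pair continuous_on_add continuous_on_scaleR continuous_on_const
        continuous_on_component continuous_on_fst continuous_on_snd continuous_on_id)
  have Ccl: "closed (C j)" for j
    unfolding Ceq by (intro closed_INT ballI closed_vimage M cont)
  have Cin: "(x, 0, z) \<in> C j" for j using xz by (auto simp: C_def fibre_power_def)
  \<comment> \<open>The middle component of the point to be projected is 0, so displacing the copy
    with index \<open>s\<close> by \<open>r j *\<^sub>R u $ s\<close> costs the squared displacement
    divided by the square of \<open>r j\<close>: this is the penalty.\<close>
  define A :: "'a \<times> ('a^'s) \<times> ('b^'s)" where "A = (x + t *\<^sub>R p, 0, z + t *\<^sub>R q)"
  have "\<exists>c. c \<in> C j \<and> (\<forall>c'\<in>C j. dist A c \<le> dist A c')" for j
  proof -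
    have "C j \<noteq> {}" using Cin[of j] by (rule ex_in_conv[THEN iffD1, OF exI])
    then obtain c0 where "c0 \<in> C j" "\<And>c'. c' \<in> C j \<Longrightarrow> dist A c0 \<le> dist A c'"
      by (rule distance_attains_inf[OF Ccl, where a = A]) blast
    then show ?thesis by (intro exI conjI ballI)
  qed
  from choice[OF allI, OF this] obtain c
    where c_min: "\<forall>j. c j \<in> C j \<and> (\<forall>c'\<in>C j. dist A (c j) \<le> dist A c')" ..
  have c: "c j \<in> C j" for j using c_min by simp
  have cmin: "dist A (c j) \<le> dist A c'" if "c' \<in> C j" for j c' using c_min that by simp
  \<comment> \<open>Comparison with the feasible point \<open>(x, 0, z)\<close> confines the
    projections for all \<open>j\<close> to one ball, so a subsequence converges.\<close>
  have Abd: "dist A (c j) \<le> t * N" for j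
  proof -
    have "dist A (c j) \<le> dist A (x, 0, z)" using cmin Cin by blast
    also have "\<dots> = norm (t *\<^sub>R (p, q))" by (simp add: A_def dist_norm norm_Pair)
    also have "\<dots> = t * N" using t unfolding norm_scaleR by (simp add: N_def)
    finally show ?thesis .
  qed
  have "c j \<in> cball A (t * N)" for j using Abd by simp
  then obtain l \<sigma> where \<sigma>: "strict_mono (\<sigma> :: nat \<Rightarrow> nat)" and l: "(c \<circ> \<sigma>) \<longlonglongrightarrow> l" "l \<in> cball A (t * N)"
    using compact_cball[of A "t * N"] unfolding compact_def by metis
  obtain x0 u0 y0 where l_eq: "l = (x0, u0, y0)" by (cases l)
  have fc: "(\<lambda>j. fst (c (\<sigma> j))) \<longlonglongrightarrow> x0" "(\<lambda>j. fst (snd (c (\<sigma> j)))) \<longlonglongrightarrow> u0"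
     "(\<lambda>j. snd (snd (c (\<sigma> j)))) \<longlonglongrightarrow> y0"
    using tendsto_fst[OF l(1)] tendsto_fst[OF tendsto_snd[OF l(1)]]
      tendsto_snd[OF tendsto_snd[OF l(1)]] by (auto simp: l_eq o_def)
  have r0: "(\<lambda>j. r (\<sigma> j)) \<longlonglongrightarrow> 0"
    using LIMSEQ_subseq_LIMSEQ[OF LIMSEQ_inverse_real_of_nat \<sigma>]
    by (simp add: r_def o_def inverse_eq_divide)
  \<comment> \<open>The \<open>u\<close> parts converge while \<open>r\<close> tends to 0, so the
    separate copies of the common variable merge and the limit lies in the fibre power.\<close>
  have ru: "(\<lambda>j. r (\<sigma> j) *\<^sub>R fst (snd (c (\<sigma> j))) $ s) \<longlonglongrightarrow> 0" for s
    using tendsto_scaleR[OF r0 tendsto_vec_nth[OF fc(2)]] by simp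
  have cM: "(fst (c j) + r j *\<^sub>R fst (snd (c j)) $ s, snd (snd (c j)) $ s) \<in> M" for j s
    using c[of j] by (auto simp: C_def)
  have lim: "(\<lambda>j. (fst (c (\<sigma> j)) + r (\<sigma> j) *\<^sub>R fst (snd (c (\<sigma> j))) $ s, snd (snd (c (\<sigma> j))) $ s))
      \<longlonglongrightarrow> (x0 + 0, y0 $ s)" for s
    by (intro tendsto_intros fc ru)
  have "(x0 + 0, y0 $ s) \<in> M" for s
    using M cM lim by (rule closed_sequentially)
  then have l\<Omega>: "(x0, y0) \<in> fibre_power M" by (simp add: fibre_power_def)
  \<comment> \<open>The projection bound gives
    \<open>norm D * norm D \<le> 2 * t * ((p, q) \<bullet> D)\<close>, and the regular normal
    inequality bounds the inner product by \<open>e3 * norm D\<close>. Hence \<open>norm D\<close>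
    is at most two thirds of \<open>t * e\<close>. The factor \<open>t\<close> matters because the
    errors of the final multipliers are displacements divided by \<open>t\<close>.\<close>
  define D where "D = (x0, y0) - (x, z)"
  have "norm (t *\<^sub>R (p, q) - D) \<le> norm (A - l)"
    by (simp add: A_def l_eq D_def norm_Pair algebra_simps)
  also have "\<dots> \<le> t * N" using l(2) by (simp add: dist_norm)
  finally have D1: "norm (t *\<^sub>R (p, q) - D) \<le> t * N" .
  have "norm D \<le> norm (t *\<^sub>R (p, q)) + norm (t *\<^sub>R (p, q) - D)"
    using norm_triangle_sub[of D "t *\<^sub>R (p, q)"] by (simp only: norm_minus_commute)
  also have "\<dots> \<le> 2 * t * N" using D1 t unfolding norm_scaleR N_def by simp
  finally have "norm D < d" using tN by simp
  then have D2: "(p, q) \<bullet> D \<le> e3 * norm D"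
    using dn[OF l\<Omega>] by (simp add: D_def dist_norm)
  have "norm (t *\<^sub>R (p, q) - D) \<le> norm (t *\<^sub>R (p, q))"
    using D1 t unfolding norm_scaleR N_def by simp
  then have "norm D * norm D \<le> 2 * ((t *\<^sub>R (p, q)) \<bullet> D)"
    by (rule norm_diff_le_imp_inner)
  then have "norm D * norm D \<le> 2 * t * ((p, q) \<bullet> D)" by (simp only: inner_scaleR_left mult.assoc)
  also have "\<dots> \<le> 2 * t * (e3 * norm D)" using D2 t by (intro mult_left_mono) auto
  finally have "norm D * norm D \<le> (2 * t * e3) * norm D" by (simp add: mult.assoc)
  then have D3: "norm D \<le> 2 * t * e3"
    using t e3 by (cases "norm D = 0") auto
  have "(\<lambda>j. (fst (c (\<sigma> j)), snd (snd (c (\<sigma> j)))) - (x, z)) \<longlonglongrightarrow> D"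
    unfolding D_def by (intro tendsto_intros fc)
  then have "(\<lambda>j. norm ((fst (c (\<sigma> j)), snd (snd (c (\<sigma> j)))) - (x, z))) \<longlonglongrightarrow> norm D"
    by (rule tendsto_norm)
  then have E1: "\<forall>\<^sub>F j in sequentially. norm ((fst (c (\<sigma> j)), snd (snd (c (\<sigma> j)))) - (x, z)) < t * e"
  proof (rule order_tendstoD(2))
    have "2 * (t * e) < 3 * (t * e)" using t e by simp
    moreover have "2 * t * e3 * 3 = 2 * (t * e)" by (simp add: e3_def)
    ultimately show "norm D < t * e" using D3 by linarith
  qed
  have E2: "\<forall>\<^sub>F j in sequentially. \<forall>s\<in>UNIV. norm (r (\<sigma> j) *\<^sub>R fst (snd (c (\<sigma> j))) $ s) < e / 2"
  proof (intro eventually_ball_finite ballI finite)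
    fix s
    show "\<forall>\<^sub>F j in sequentially. norm (r (\<sigma> j) *\<^sub>R fst (snd (c (\<sigma> j))) $ s) < e / 2"
      using tendsto_norm[OF ru[of s]] e by (intro order_tendstoD) auto
  qed
  obtain k where
    k: "norm ((fst (c (\<sigma> k)), snd (snd (c (\<sigma> k)))) - (x, z)) < t * e \<and>
      (\<forall>s\<in>UNIV. norm (r (\<sigma> k) *\<^sub>R fst (snd (c (\<sigma> k))) $ s) < e / 2)"
    using eventually_happens'[OF sequentially_bot eventually_conj[OF E1 E2]] by blast
  define j where "j = \<sigma> k"
  obtain x' u y where cj: "c j = (x', u, y)" by (cases "c j")
  have x'y: "norm ((x' - x, y - z)) < t * e" and u2: "\<And>s. norm (r j *\<^sub>R u $ s) < e / 2"
    using k cj by (auto simp: j_def)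
  have xx: "norm (x' - x) < t * e" and yz: "norm (y - z) < t * e"
    using x'y norm_fst_le[of "x' - x" "y - z"] norm_snd_le[of "y - z" "x' - x"] by linarith+
  have prox: "(A - c j) \<bullet> w \<le> (norm w)\<^sup>2 / 2" if "c j + w \<in> C j" for w
    using closest_point_proximal cmin that by blast
  \<comment> \<open>Stationarity in the coupling directions: shifting \<open>x'\<close> by
    \<open>b\<close> and every \<open>u $ s\<close> by \<open>- b / r j\<close> leaves all the
    copies fixed, so every step size is feasible. The choice of \<open>b\<close> makes the inner
    product with \<open>w\<close> equal to \<open>b \<bullet> b\<close>.\<close>
  have sum_u: "x' - x - t *\<^sub>R p = (\<Sum>s\<in>UNIV. (1 / r j) *\<^sub>R u $ s)"
  proof -
    define b where "b = (x + t *\<^sub>R p - x') + (\<Sum>s\<in>UNIV. (1 / r j) *\<^sub>R u $ s)"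
    define w where "w = (b, (\<chi> s. (- 1 / r j) *\<^sub>R b) :: 'a^'s, 0::'b^'s)"
    have "(A - c j) \<bullet> w \<le> 0"
    proof (rule inner_nonpos_if_small_steps)
      fix \<tau> :: real
      have "c j + \<tau> *\<^sub>R w \<in> C j"
        using c[of j] r[of j] by (auto simp: w_def C_def cj algebra_simps)
      then show "(A - c j) \<bullet> (\<tau> *\<^sub>R w) \<le> (norm (\<tau> *\<^sub>R w))\<^sup>2 / 2" by (rule prox)
    qed
    moreover have "(A - c j) \<bullet> w = b \<bullet> b"
      by (simp add: w_def A_def cj b_def inner_vec_def inner_add_left inner_sum_left
          inner_diff_left sum_negf sum_divide_distrib)
    ultimately have "b = 0" by (metis inner_eq_zero_iff inner_ge_zero order_antisym)
    then show ?thesis by (simp add: b_def algebra_simps)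
  qed
  \<comment> \<open>Only the factor with index \<open>s\<close> is varied: a move by
    \<open>(\<xi>, \<eta>)\<close> inside \<open>M\<close> is realised by changing
    \<open>u $ s\<close> by \<open>\<xi> / r j\<close> and \<open>y $ s\<close> by
    \<open>\<eta>\<close>. The projection inequality then becomes a proximal inequality for
    \<open>M\<close>, and the rescaling of \<open>\<xi>\<close> accounts for the constant.\<close>
  have normal: "(- (1 / r j) *\<^sub>R u $ s, z $ s + t *\<^sub>R q $ s - y $ s)
      \<in> regular_normal_cone M (x' + r j *\<^sub>R u $ s, y $ s)" for s
  proof (rule proximal_imp_regular_normal[where c = "((1 / r j)\<^sup>2 + 1) / 2"])
    fix w' assume w': "w' \<in> M"
    obtain X1 Y1 where w'_eq: "w' = (X1, Y1)" by (cases w')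
    define \<xi> \<eta> where "\<xi> = X1 - (x' + r j *\<^sub>R u $ s)" and "\<eta> = Y1 - y $ s"
    define w :: "'a \<times> ('a^'s) \<times> ('b^'s)" where "w = (0, axis s ((1 / r j) *\<^sub>R \<xi>), axis s \<eta>)"
    have "c j + w \<in> C j"
      using c[of j] w' r[of j] unfolding C_def cj w_def w'_eq
      by (auto simp: axis_def \<xi>_def \<eta>_def algebra_simps)
    then have "(A - c j) \<bullet> w \<le> (norm w)\<^sup>2 / 2" by (rule prox)
    moreover have "(A - c j) \<bullet> w = (- (1 / r j) *\<^sub>R u $ s, z $ s + t *\<^sub>R q $ s - y $ s) \<bullet> (\<xi>, \<eta>)"
      by (simp add: A_def w_def cj inner_axis)
    moreover have "(norm w)\<^sup>2 \<le> ((1 / r j)\<^sup>2 + 1) * (norm (\<xi>, \<eta>))\<^sup>2"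
      unfolding power2_norm_eq_inner w_def
      using divide_nonneg_nonneg[OF inner_ge_zero[of \<eta>], of "r j * r j"]
      by (simp add: inner_axis_axis algebra_simps power2_eq_square add_divide_distrib add_nonneg_nonneg)
    moreover have "w' - (x' + r j *\<^sub>R u $ s, y $ s) = (\<xi>, \<eta>)" by (simp add: w'_eq \<xi>_def \<eta>_def)
    ultimately show "(- (1 / r j) *\<^sub>R u $ s, z $ s + t *\<^sub>R q $ s - y $ s) \<bullet>
       (w' - (x' + r j *\<^sub>R u $ s, y $ s)) \<le>
       ((1 / r j)\<^sup>2 + 1) / 2 * (norm (w' - (x' + r j *\<^sub>R u $ s, y $ s)))\<^sup>2" by simp
  qed
  define X where "X = (\<chi> s. x' + r j *\<^sub>R u $ s)"
  \<comment> \<open>Division by \<open>t\<close> undoes the step length. By \<open>sum_u\<close> the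
    sum of the \<open>U $ s\<close> differs from \<open>p\<close> by \<open>(x' - x) / t\<close>,
    and likewise \<open>V\<close> from \<open>q\<close> by \<open>(y - z) / t\<close>.\<close>
  define U where "U = (\<chi> s. (1 / t) *\<^sub>R (- (1 / r j) *\<^sub>R u $ s))"
  define V where "V = (1 / t) *\<^sub>R (z + t *\<^sub>R q - y)"
  show thesis
  proof
    show "(X $ s, y $ s) \<in> M" for s using cM[of j s] by (simp add: X_def cj)
    show "(U $ s, V $ s) \<in> regular_normal_cone M (X $ s, y $ s)" for s
      using regular_normal_cone_scaleR[OF normal[of s], of "1 / t"] t
      by (simp add: X_def U_def V_def)
    have te: "t * e \<le> e / 2" using t1 e by (simp add: field_simps)
    show "dist (X $ s) x < e" for s
    proof -
      have "dist (X $ s) x \<le> norm (x' - x) + norm (r j *\<^sub>R u $ s)"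
        using norm_triangle_ineq[of "x' - x" "r j *\<^sub>R u $ s"]
        by (simp add: X_def dist_norm algebra_simps)
      then show ?thesis using u2[of s] xx te by linarith
    qed
    show "dist y z < e" using yz te e unfolding dist_norm by linarith
    have "(\<Sum>s\<in>UNIV. U $ s) = - (1 / t) *\<^sub>R (\<Sum>s\<in>UNIV. (1 / r j) *\<^sub>R u $ s)"
      by (simp add: U_def scaleR_sum_right sum_negf)
    also have "\<dots> = p - (1 / t) *\<^sub>R (x' - x)"
      using t by (simp add: sum_u[symmetric] algebra_simps)
    finally show "dist (\<Sum>s\<in>UNIV. U $ s) p < e"
      using xx t by (simp add: dist_norm pos_divide_less_eq mult.commute)
    have "V = q - (1 / t) *\<^sub>R (y - z)" using t by (simp add: V_def algebra_simps)
    then show "dist V q < e" using yz t by (simp add: dist_norm pos_divide_less_eq mult.commute)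
  qed
qed

lemma limiting_normal_coneI:
  assumes "vs \<longlonglongrightarrow> v" "zs \<longlonglongrightarrow> z"
    "\<And>k. zs k \<in> C" "\<And>k. vs k \<in> regular_normal_cone C (zs k)"
  shows "v \<in> limiting_normal_cone C z"
  unfolding limiting_normal_cone_def using assms by blast

lemma inverse_Suc_tendsto: "(\<lambda>k. 1 / real (Suc k)) \<longlonglongrightarrow> 0"
  using LIMSEQ_inverse_real_of_nat by (simp add: inverse_eq_divide)

lemma tendsto_of_dist_less_inverse_Suc:
  fixes X L :: "nat \<Rightarrow> 'a::real_normed_vector"
  assumes "\<And>k. dist (X k) (L k) < 1 / real (Suc k)" "L \<longlonglongrightarrow> l"
  shows "X \<longlonglongrightarrow> l"
proof -
  have "(\<lambda>k. dist (X k) (L k)) \<longlonglongrightarrow> 0"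
    by (rule tendsto_sandwich[OF _ _ tendsto_const inverse_Suc_tendsto])
      (use assms(1) in \<open>auto intro!: always_eventually simp: less_imp_le\<close>)
  then have "(\<lambda>k. X k - L k) \<longlonglongrightarrow> 0"
    by (simp add: dist_norm tendsto_norm_zero_iff)
  from tendsto_add[OF this assms(2)] show ?thesis by simp
qed

text \<open>Normalising by \<open>1 + \<parallel>U\<parallel>\<close> treats bounded and unbounded multipliers at once: if the
  scaling factors tend to \<open>0\<close>, the normalised limit violates the qualification.\<close>

lemma limiting_normal_cone_fibre_power:
  fixes M :: "('a::euclidean_space \<times> 'b::euclidean_space) set" and z q :: "'b^'s"
  assumes M: "closed M"
    and pq: "(p, q) \<in> limiting_normal_cone (fibre_power M) (x, z)"
    and qual: "\<And>v :: 'a^'s. (\<Sum>s\<in>UNIV. v $ s) = 0 \<Longrightarrow>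
      (\<And>s. (v $ s, 0) \<in> limiting_normal_cone M (x, z $ s)) \<Longrightarrow> v = 0"
  obtains v :: "'a^'s" where "(\<Sum>s\<in>UNIV. v $ s) = p"
    "\<And>s. (v $ s, q $ s) \<in> limiting_normal_cone M (x, z $ s)"
proof -
  obtain vs zs where vs: "vs \<longlonglongrightarrow> (p, q)" and zs: "zs \<longlonglongrightarrow> (x, z)"
    and zM: "\<And>k. zs k \<in> fibre_power M"
    and vN: "\<And>k. vs k \<in> regular_normal_cone (fibre_power M) (zs k)"
    using pq unfolding limiting_normal_cone_def mem_Collect_eq by blast
  define P where "P k X Y U V \<longleftrightarrow> (\<forall>s. (X $ s, Y $ s) \<in> M) \<and>
      (\<forall>s. (U $ s, V $ s) \<in> regular_normal_cone M (X $ s, Y $ s)) \<and>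
      (\<forall>s. dist (X $ s) (fst (zs k)) < 1 / real (Suc k)) \<and>
      dist Y (snd (zs k)) < 1 / real (Suc k) \<and>
      dist (\<Sum>s\<in>UNIV. U $ s) (fst (vs k)) < 1 / real (Suc k) \<and>
      dist V (snd (vs k)) < 1 / real (Suc k)"
    for k and X U :: "'a^'s" and Y V :: "'b^'s"
  have "\<exists>X Y U V. P k X Y U V" for k
  proof -
    have "(fst (zs k), snd (zs k)) \<in> fibre_power M" "1 / real (Suc k) > 0"
      "(fst (vs k), snd (vs k)) \<in> regular_normal_cone (fibre_power M) (fst (zs k), snd (zs k))"
      using zM vN by simp_all
    then obtain X Y U V where "\<And>s. (X $ s, Y $ s) \<in> M"
      "\<And>s. (U $ s, V $ s) \<in> regular_normal_cone M (X $ s, Y $ s)"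
      "\<And>s. dist (X $ s) (fst (zs k)) < 1 / real (Suc k)"
      "dist Y (snd (zs k)) < 1 / real (Suc k)"
      "dist (\<Sum>s\<in>UNIV. U $ s) (fst (vs k)) < 1 / real (Suc k)"
      "dist V (snd (vs k)) < 1 / real (Suc k)"
      using regular_normal_fibre_power_fuzzy[OF M] by blast
    then have "P k X Y U V" unfolding P_def by (intro conjI allI)
    then show ?thesis by (intro exI)
  qed
  then obtain X Y U V where P: "\<And>k. P k (X k) (Y k) (U k) (V k)" by metis
  have XM: "(X k $ s, Y k $ s) \<in> M"
    and UN: "(U k $ s, V k $ s) \<in> regular_normal_cone M (X k $ s, Y k $ s)"
    and X0: "dist (X k $ s) (fst (zs k)) < 1 / real (Suc k)"
    and Y0: "dist (Y k) (snd (zs k)) < 1 / real (Suc k)"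
    and U0: "dist (\<Sum>s\<in>UNIV. U k $ s) (fst (vs k)) < 1 / real (Suc k)"
    and V0: "dist (V k) (snd (vs k)) < 1 / real (Suc k)" for k s
    using P[of k] unfolding P_def by blast+
  have X: "(\<lambda>k. X k $ s) \<longlonglongrightarrow> x" for s
    using tendsto_fst[OF zs] by (intro tendsto_of_dist_less_inverse_Suc[OF X0]) simp
  have Y: "Y \<longlonglongrightarrow> z"
    using tendsto_snd[OF zs] by (intro tendsto_of_dist_less_inverse_Suc[OF Y0]) simp
  have U: "(\<lambda>k. \<Sum>s\<in>UNIV. U k $ s) \<longlonglongrightarrow> p"
    using tendsto_fst[OF vs] by (intro tendsto_of_dist_less_inverse_Suc[OF U0]) simp
  have V: "V \<longlonglongrightarrow> q"
    using tendsto_snd[OF vs] by (intro tendsto_of_dist_less_inverse_Suc[OF V0]) simp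
  define \<tau> where "\<tau> k = 1 / (1 + norm (U k))" for k
  define W where "W k = \<tau> k *\<^sub>R U k" for k
  have \<tau>: "0 < \<tau> k" "\<tau> k \<le> 1" for k by (simp_all add: \<tau>_def add_pos_nonneg divide_simps)
  have nW: "norm (W k) = 1 - \<tau> k" for k
    using \<tau>[of k] by (simp add: W_def \<tau>_def field_simps add_nonneg_eq_0_iff)
  have "(\<tau> k, W k) \<in> {0..1} \<times> cball 0 1" for k
    using \<tau>[of k] nW[of k] by (auto simp: less_imp_le)
  then have in_box: "\<forall>k. (\<tau> k, W k) \<in> {0..1} \<times> cball 0 1" ..
  have "compact ({0..1::real} \<times> cball (0 :: 'a^'s) 1)" by (intro compact_Times) auto
  then have "seq_compact ({0..1::real} \<times> cball (0 :: 'a^'s) 1)" by (rule compact_imp_seq_compact)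
  then obtain l \<sigma> where \<sigma>: "strict_mono (\<sigma> :: nat \<Rightarrow> nat)"
    and l: "((\<lambda>k. (\<tau> k, W k)) \<circ> \<sigma>) \<longlonglongrightarrow> l"
    using in_box by (rule seq_compactE)
  obtain \<tau>0 w where l_eq: "l = (\<tau>0, w)" by (cases l)
  have \<tau>lim: "(\<lambda>k. \<tau> (\<sigma> k)) \<longlonglongrightarrow> \<tau>0" and Wlim: "(\<lambda>k. W (\<sigma> k)) \<longlonglongrightarrow> w"
    using tendsto_fst[OF l] tendsto_snd[OF l] by (auto simp: l_eq o_def)
  have X': "(\<lambda>k. X (\<sigma> k) $ s) \<longlonglongrightarrow> x" for s using LIMSEQ_subseq_LIMSEQ[OF X \<sigma>] by (simp add: o_def)
  have Y': "(\<lambda>k. Y (\<sigma> k)) \<longlonglongrightarrow> z" using LIMSEQ_subseq_LIMSEQ[OF Y \<sigma>] by (simp add: o_def)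
  have U': "(\<lambda>k. \<Sum>s\<in>UNIV. U (\<sigma> k) $ s) \<longlonglongrightarrow> p" using LIMSEQ_subseq_LIMSEQ[OF U \<sigma>] by (simp add: o_def)
  have V': "(\<lambda>k. V (\<sigma> k)) \<longlonglongrightarrow> q" using LIMSEQ_subseq_LIMSEQ[OF V \<sigma>] by (simp add: o_def)
  have XY': "(\<lambda>k. (X (\<sigma> k) $ s, Y (\<sigma> k) $ s)) \<longlonglongrightarrow> (x, z $ s)" for s
    by (intro tendsto_Pair X' tendsto_vec_nth Y')
  \<comment> \<open>If the factors tended to 0, then \<open>norm w = 1\<close> by \<open>nW\<close>,
    while the components of \<open>w\<close> would sum to \<open>0 *\<^sub>R p\<close> and the
    convergent parts \<open>V\<close> would be scaled to 0. So \<open>w\<close> would be a nonzero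
    family excluded by \<open>qual\<close>.\<close>
  have "\<tau>0 \<noteq> 0"
  proof
    assume "\<tau>0 = 0"
    have "(\<lambda>k. norm (W (\<sigma> k))) \<longlonglongrightarrow> 1 - \<tau>0"
      unfolding nW by (intro tendsto_diff tendsto_const \<tau>lim)
    with tendsto_norm[OF Wlim] have "norm w = 1 - \<tau>0" using LIMSEQ_unique by blast
    then have "w \<noteq> 0" using \<open>\<tau>0 = 0\<close> by auto
    have "(\<lambda>k. \<tau> (\<sigma> k) *\<^sub>R (\<Sum>s\<in>UNIV. U (\<sigma> k) $ s)) \<longlonglongrightarrow> \<tau>0 *\<^sub>R p"
      by (intro tendsto_scaleR \<tau>lim U')
    moreover have "(\<lambda>k. \<Sum>s\<in>UNIV. W (\<sigma> k) $ s) \<longlonglongrightarrow> (\<Sum>s\<in>UNIV. w $ s)"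
      by (intro tendsto_sum tendsto_vec_nth Wlim)
    ultimately have "(\<Sum>s\<in>UNIV. w $ s) = 0"
      using LIMSEQ_unique \<open>\<tau>0 = 0\<close> by (fastforce simp: W_def scaleR_sum_right)
    moreover have "(w $ s, 0) \<in> limiting_normal_cone M (x, z $ s)" for s
    proof (rule limiting_normal_coneI[OF _ XY' XM])
      show "\<tau> (\<sigma> k) *\<^sub>R (U (\<sigma> k) $ s, V (\<sigma> k) $ s)
          \<in> regular_normal_cone M (X (\<sigma> k) $ s, Y (\<sigma> k) $ s)" for k
        by (rule regular_normal_cone_scaleR[OF UN \<tau>(1)])
      have "(\<lambda>k. (W (\<sigma> k) $ s, \<tau> (\<sigma> k) *\<^sub>R V (\<sigma> k) $ s)) \<longlonglongrightarrow> (w $ s, \<tau>0 *\<^sub>R q $ s)"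
        by (intro tendsto_Pair tendsto_scaleR tendsto_vec_nth Wlim \<tau>lim V')
      then show "(\<lambda>k. \<tau> (\<sigma> k) *\<^sub>R (U (\<sigma> k) $ s, V (\<sigma> k) $ s)) \<longlonglongrightarrow> (w $ s, 0)"
        using \<open>\<tau>0 = 0\<close> by (simp add: W_def)
    qed
    ultimately show False using qual \<open>w \<noteq> 0\<close> by blast
  qed
  \<comment> \<open>With a nonzero limit of the factors the normalisation can be undone, so the
    multipliers \<open>U\<close> themselves converge along the subsequence.\<close>
  define v where "v = (1 / \<tau>0) *\<^sub>R w"
  have "(\<lambda>k. (1 / \<tau> (\<sigma> k)) *\<^sub>R W (\<sigma> k)) \<longlonglongrightarrow> v"
    unfolding v_def by (intro tendsto_scaleR tendsto_divide tendsto_const \<tau>lim Wlim \<open>\<tau>0 \<noteq> 0\<close>)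
  moreover have "(1 / \<tau> k) *\<^sub>R W k = U k" for k using \<tau>(1)[of k] by (simp add: W_def)
  ultimately have Ulim: "(\<lambda>k. U (\<sigma> k)) \<longlonglongrightarrow> v" by simp
  show thesis
  proof
    have "(\<lambda>k. \<Sum>s\<in>UNIV. U (\<sigma> k) $ s) \<longlonglongrightarrow> (\<Sum>s\<in>UNIV. v $ s)"
      by (intro tendsto_sum tendsto_vec_nth Ulim)
    with U' show "(\<Sum>s\<in>UNIV. v $ s) = p" using LIMSEQ_unique by blast
    show "(v $ s, q $ s) \<in> limiting_normal_cone M (x, z $ s)" for s
      by (rule limiting_normal_coneI[OF _ XY' XM UN])
        (intro tendsto_Pair tendsto_vec_nth Ulim V')
  qed
qed

section \<open>Clarke subdifferential of a marginal function\<close>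

lemma Limsup_mono_filter: "F \<le> G \<Longrightarrow> Limsup F f \<le> Limsup G f"
  unfolding Limsup_def by (rule INF_superset_mono) (auto simp: le_filter_def)

text \<open>An intersection of half-spaces. The convex combination is compared with the larger of
  the two real inner products, which avoids arithmetic with the extended real directional
  derivative.\<close>

lemma convex_clarke_subdifferential: "convex (clarke_subdifferential \<phi> x)"
  unfolding convex_alt clarke_subdifferential_def
proof (intro ballI allI impI CollectI, elim conjE CollectE)
  fix v w :: 'a and u :: real and d
  assume v: "\<forall>d. ereal (v \<bullet> d) \<le> clarke_dir_deriv \<phi> x d"
    and w: "\<forall>d. ereal (w \<bullet> d) \<le> clarke_dir_deriv \<phi> x d" and u: "0 \<le> u" "u \<le> 1"
  have "((1 - u) *\<^sub>R v + u *\<^sub>R w) \<bullet> d \<le> (1 - u) * max (v \<bullet> d) (w \<bullet> d) + u * max (v \<bullet> d) (w \<bullet> d)"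
    using u by (simp add: inner_add_left add_mono mult_left_mono)
  also have "\<dots> = max (v \<bullet> d) (w \<bullet> d)" by (simp add: algebra_simps)
  finally have "ereal (((1 - u) *\<^sub>R v + u *\<^sub>R w) \<bullet> d) \<le> max (ereal (v \<bullet> d)) (ereal (w \<bullet> d))"
    by (simp add: max_def split: if_splits)
  also have "\<dots> \<le> clarke_dir_deriv \<phi> x d" using v w by simp
  finally show "ereal (((1 - u) *\<^sub>R v + u *\<^sub>R w) \<bullet> d) \<le> clarke_dir_deriv \<phi> x d" .
qed

section \<open>Danskin's formula for a minimum over a compact set\<close>

context
  fixes f :: "'a::euclidean_space \<times> 'b::euclidean_space \<Rightarrow> real"
    and F :: "'a \<times> 'b \<Rightarrow> 'a" and S :: "'a \<Rightarrow> 'b set" and Y :: "'b set" and \<phi> :: "'a \<Rightarrow> real"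
  assumes Y: "compact Y" and F: "continuous_on UNIV F"
    and f_der: "\<And>u y. ((\<lambda>u. f (u, y)) has_derivative (\<lambda>h. F (u, y) \<bullet> h)) (at u)"
    and S_closed: "closed (graph_of S)" and S_ne: "\<And>u. S u \<noteq> {}" and S_sub: "\<And>u. S u \<subseteq> Y"
    and \<phi>_eq: "\<And>u y. y \<in> S u \<Longrightarrow> \<phi> u = f (u, y)"
    and \<phi>_le: "\<And>u y. y \<in> Y \<Longrightarrow> \<phi> u \<le> f (u, y)"
begin

lemma f_line_derivative:
  "((\<lambda>t. f (u + t *\<^sub>R d, y)) has_real_derivative F (u + t *\<^sub>R d, y) \<bullet> d) (at t within T)"
proof -
  have "((\<lambda>t. u + t *\<^sub>R d) has_derivative (\<lambda>h. h *\<^sub>R d)) (at t within T)"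
    by (auto intro!: derivative_eq_intros)
  from has_derivative_compose[OF this f_der]
  have "((\<lambda>t. f (u + t *\<^sub>R d, y)) has_derivative (\<lambda>h. F (u + t *\<^sub>R d, y) \<bullet> (h *\<^sub>R d)))
      (at t within T)" .
  then show ?thesis
    unfolding has_field_derivative_def by (rule has_derivative_eq_rhs) (auto simp: mult.commute)
qed

text \<open>The base points \<open>x - t d\<close>, together with \<open>\<phi> \<le> f(\<cdot>, z)\<close> and equality at \<open>x\<close>, already
  produce the directional derivative of \<open>f(\<cdot>, z)\<close>.\<close>

lemma gradient_in_clarke_subdifferential:
  assumes z: "z \<in> S x"
  shows "F (x, z) \<in> clarke_subdifferential \<phi> x"
  unfolding clarke_subdifferential_def mem_Collect_eq
proof
  fix d
  define g where "g = (\<lambda>(x', t). ereal ((\<phi> (x' + t *\<^sub>R d) - \<phi> x') / t))"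
  define m where "m t = (x - t *\<^sub>R d, t)" for t :: real
  have "((\<lambda>t. x - t *\<^sub>R d) \<longlongrightarrow> x - 0 *\<^sub>R d) (at_right 0)" by (intro tendsto_intros)
  then have m: "filterlim m (nhds x \<times>\<^sub>F at_right 0) (at_right 0)"
    unfolding m_def by (intro filterlim_Pair filterlim_ident) simp
  \<comment> \<open>The derivative in direction \<open>- d\<close>, restricted to
    \<open>t > 0\<close> and negated, is the limit of the backward difference quotients along the
    path \<open>m\<close>.\<close>
  have "((\<lambda>t. f (x + t *\<^sub>R (- d), z)) has_real_derivative F (x + 0 *\<^sub>R (- d), z) \<bullet> (- d)) (at 0)"
    by (rule f_line_derivative)
  then have "((\<lambda>t. (f (x - t *\<^sub>R d, z) - f (x, z)) / t) \<longlongrightarrow> - (F (x, z) \<bullet> d)) (at 0)"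
    by (simp add: has_field_derivative_iff)
  then have "((\<lambda>t. (f (x - t *\<^sub>R d, z) - f (x, z)) / t) \<longlongrightarrow> - (F (x, z) \<bullet> d)) (at_right 0)"
    by (rule filterlim_mono[OF _ order_refl at_le]) simp
  from tendsto_minus[OF this]
  have lim: "((\<lambda>t. (f (x, z) - f (x - t *\<^sub>R d, z)) / t) \<longlongrightarrow> F (x, z) \<bullet> d) (at_right 0)"
    by (simp add: minus_divide_left)
  have "ereal (F (x, z) \<bullet> d) = Limsup (at_right 0) (\<lambda>t. ereal ((f (x, z) - f (x - t *\<^sub>R d, z)) / t))"
    by (rule lim_imp_Limsup[symmetric]) (use lim in auto)
  also have "\<dots> \<le> Limsup (at_right 0) (\<lambda>t. g (m t))"
  proof (rule Limsup_mono)
    have "\<forall>\<^sub>F t :: real in at_right 0. t > 0" by (simp add: eventually_at_right_less)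
    then show "\<forall>\<^sub>F t in at_right 0. ereal ((f (x, z) - f (x - t *\<^sub>R d, z)) / t) \<le> g (m t)"
    proof eventually_elim
      case (elim t)
      then show ?case using \<phi>_eq[OF z] \<phi>_le[of z "x - t *\<^sub>R d"] z S_sub[of x]
        by (auto simp: g_def m_def intro!: divide_right_mono)
    qed
  qed
  also have "\<dots> \<le> Limsup (filtermap m (at_right 0)) g" by (rule Limsup_filtermap_ge)
  also have "\<dots> \<le> Limsup (nhds x \<times>\<^sub>F at_right 0) g"
    using m unfolding filterlim_def by (rule Limsup_mono_filter)
  finally show "ereal (F (x, z) \<bullet> d) \<le> clarke_dir_deriv \<phi> x d"
    by (simp add: clarke_dir_deriv_def g_def)
qed

text \<open>For \<open>y \<in> S x'\<close> the difference quotient of \<open>\<phi>\<close> is at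
  most that of \<open>f\<close> with \<open>y\<close> fixed, which by the mean value theorem is
  \<open>F (\<xi>, y) \<bullet> d\<close> at an intermediate point. Closedness of the graph and
  compactness of \<open>Y\<close> extend the strict bound from \<open>x\<close> to nearby
  points.\<close>

lemma clarke_dir_deriv_le:
  assumes "\<And>y. y \<in> S x \<Longrightarrow> F (x, y) \<bullet> d < \<beta>"
  shows "clarke_dir_deriv \<phi> x d \<le> ereal \<beta>"
  unfolding clarke_dir_deriv_def
proof (rule Limsup_bounded)
  \<comment> \<open>The triples that violate the bound. The base point \<open>x'\<close> and the
    mean value point \<open>\<xi>\<close> are kept apart since they differ. Projecting out
    \<open>y\<close> over the compact \<open>Y\<close> gives the closed set \<open>B\<close>, whose
    complement is the required neighbourhood of \<open>(x, x)\<close>.\<close>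
  define T where "T = {(y, x', \<xi>). (x', y) \<in> graph_of S \<and> F (\<xi>, y) \<bullet> d \<ge> \<beta>}"
  have "closed ((\<lambda>w :: 'b \<times> 'a \<times> 'a. (fst (snd w), fst w)) -` graph_of S)"
    by (intro closed_vimage S_closed continuous_on_Pair continuous_on_fst continuous_on_snd
        continuous_on_id)
  moreover have "closed {w :: 'b \<times> 'a \<times> 'a. \<beta> \<le> F (snd (snd w), fst w) \<bullet> d}"
    by (intro closed_Collect_le continuous_on_const continuous_on_inner continuous_on_compose2[OF F]
        continuous_on_Pair continuous_on_fst continuous_on_snd continuous_on_id) auto
  moreover have "T = (\<lambda>w. (fst (snd w), fst w)) -` graph_of S \<inter>
      {w. \<beta> \<le> F (snd (snd w), fst w) \<bullet> d}"
    by (auto simp: T_def)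
  ultimately have "closed T" by (simp add: closed_Int)
  define B where "B = {w. \<exists>y. y \<in> Y \<and> (y, w) \<in> T}"
  have "closed B" unfolding B_def using Y \<open>closed T\<close> by (rule closed_compact_projection)
  then have "open (- B)" by (rule open_Compl)
  moreover have "(x, x) \<in> - B"
    using assms by (force simp: B_def T_def graph_of_def)
  ultimately obtain \<delta> where \<delta>: "\<delta> > 0" "ball (x, x) \<delta> \<subseteq> - B" by (rule openE)
  have bound: "F (\<xi>, y) \<bullet> d < \<beta>"
    if "dist x' x < \<delta> / 2" "dist \<xi> x < \<delta> / 2" "y \<in> S x'" for x' \<xi> y
  proof -
    have "dist (x, x) (x', \<xi>) \<le> dist x x' + dist x \<xi>"
      by (simp add: dist_Pair_Pair sqrt_sum_squares_le_sum)
    then have "(x', \<xi>) \<notin> B" using \<delta>(2) that by (auto simp: dist_commute subset_eq)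
    then show ?thesis
      using that(3) S_sub[of x'] by (auto simp: B_def T_def graph_of_def)
  qed
  \<comment> \<open>A step shorter than \<open>e\<close> moves a point by at most
    \<open>\<delta> / 4\<close>; with a base point within \<open>\<delta> / 4\<close> of
    \<open>x\<close>, the mean value point stays within \<open>\<delta> / 2\<close>. The summand 1
    covers \<open>d = 0\<close>.\<close>
  define e where "e = \<delta> / (4 * (norm d + 1))"
  have e: "e > 0" using \<delta> by (simp add: e_def add_nonneg_pos)
  have "\<forall>\<^sub>F w in nhds x \<times>\<^sub>F at_right (0 :: real). dist (fst w) x < \<delta> / 4 \<and> 0 < snd w \<and> snd w < e"
  proof -
    have "\<forall>\<^sub>F x' in nhds x. dist x' x < \<delta> / 4"
      using \<delta>(1) by (auto simp: eventually_nhds_metric intro!: exI[of _ "\<delta> / 4"])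
    moreover have "\<forall>\<^sub>F t in at_right (0::real). 0 < t \<and> t < e"
      using e by (auto simp: eventually_at_right[OF e])
    ultimately show ?thesis by (auto simp: eventually_prod_filter)
  qed
  then show "\<forall>\<^sub>F w in nhds x \<times>\<^sub>F at_right 0.
      (case w of (x', t) \<Rightarrow> ereal ((\<phi> (x' + t *\<^sub>R d) - \<phi> x') / t)) \<le> ereal \<beta>"
  proof eventually_elim
    case (elim w)
    obtain x' t where w: "w = (x', t)" by (cases w)
    have x': "dist x' x < \<delta> / 4" and t: "0 < t" "t < e" using elim by (auto simp: w)
    obtain y where y: "y \<in> S x'" using S_ne by blast
    obtain \<tau> where \<tau>: "0 < \<tau>" "\<tau> < t"
      and mvt: "f (x' + t *\<^sub>R d, y) - f (x' + 0 *\<^sub>R d, y) = (t - 0) * (F (x' + \<tau> *\<^sub>R d, y) \<bullet> d)"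
      using MVT2[OF t(1), of "\<lambda>t. f (x' + t *\<^sub>R d, y)" "\<lambda>t. F (x' + t *\<^sub>R d, y) \<bullet> d"]
        f_line_derivative by blast
    have "\<tau> * norm d \<le> e * (norm d + 1)" using \<tau> t e by (intro mult_mono) auto
    also have "\<dots> = \<delta> / 4"
    proof -
      have "norm d + 1 \<noteq> 0" using norm_ge_zero[of d] by linarith
      then show ?thesis unfolding e_def by (metis times_divide_eq_left mult_divide_mult_cancel_right)
    qed
    finally have "norm (\<tau> *\<^sub>R d) \<le> \<delta> / 4" using \<tau> by simp
    then have "dist (x' + \<tau> *\<^sub>R d) x < \<delta> / 2"
      using x' norm_triangle_ineq[of "x' - x" "\<tau> *\<^sub>R d"] by (simp add: dist_norm algebra_simps)
    moreover have "dist x' x < \<delta> / 2" using x' \<delta>(1) by linarith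
    ultimately have "F (x' + \<tau> *\<^sub>R d, y) \<bullet> d < \<beta>" using bound y by blast
    then have "t * (F (x' + \<tau> *\<^sub>R d, y) \<bullet> d) \<le> t * \<beta>" using t by simp
    moreover have "\<phi> (x' + t *\<^sub>R d) - \<phi> x' \<le> f (x' + t *\<^sub>R d, y) - f (x', y)"
      using \<phi>_eq[OF y] \<phi>_le y S_sub[of x'] by (simp add: subset_iff)
    ultimately have "\<phi> (x' + t *\<^sub>R d) - \<phi> x' \<le> t * \<beta>" using mvt by simp
    then show ?case using t by (simp add: w divide_le_eq mult.commute)
  qed
qed

text \<open>A point outside the compact convex hull is strictly separated from it by some
  \<open>a\<close>, and \<open>clarke_dir_deriv_le\<close> in the direction \<open>- a\<close>
  contradicts the subgradient inequality.\<close>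

lemma clarke_subdifferential_subset:
  "clarke_subdifferential \<phi> x \<subseteq> convex hull ((\<lambda>y. F (x, y)) ` S x)"
proof (rule subsetI, rule ccontr)
  fix p
  let ?K = "convex hull ((\<lambda>y. F (x, y)) ` S x)"
  assume p: "p \<in> clarke_subdifferential \<phi> x" and nK: "p \<notin> ?K"
  have "closed (Pair x -` graph_of S)"
    by (intro closed_vimage S_closed continuous_on_Pair continuous_on_const continuous_on_id)
  then have "closed (S x)" by (simp add: graph_of_def vimage_def)
  then have "compact (Y \<inter> S x)" by (rule compact_Int_closed[OF Y])
  then have "compact (S x)" using S_sub[of x] by (simp add: Int_absorb1)
  moreover have "continuous_on (S x) (\<lambda>y. F (x, y))"
    by (intro continuous_on_compose2[OF F] continuous_on_Pair continuous_on_const continuous_on_id) auto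
  ultimately have "compact ?K" by (intro compact_convex_hull compact_continuous_image)
  then obtain a b where ab: "a \<bullet> p < b" "\<And>k. k \<in> ?K \<Longrightarrow> a \<bullet> k > b"
    using separating_hyperplane_closed_point[OF convex_convex_hull compact_imp_closed nK] by blast
  have "F (x, y) \<bullet> (- a) < - b" if "y \<in> S x" for y
    using ab(2)[OF hull_inc, of "F (x, y)"] that by (simp add: inner_commute)
  then have "clarke_dir_deriv \<phi> x (- a) \<le> ereal (- b)" by (rule clarke_dir_deriv_le)
  moreover have "ereal (p \<bullet> (- a)) \<le> clarke_dir_deriv \<phi> x (- a)"
    using p unfolding clarke_subdifferential_def by blast
  ultimately have "ereal (p \<bullet> (- a)) \<le> ereal (- b)" by (rule order_trans[rotated])
  then show False using ab(1) by (simp add: inner_commute)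
qed

end

text \<open>Caratheodory's theorem on a fixed index type with n + 1 elements: the at most n + 1
  points are injected into it, and the remaining indices get weight 0 together with an arbitrary
  \<open>y0 \<in> S\<close>, so that membership in \<open>S\<close> holds at every index.\<close>

lemma convex_hull_image_indexed:
  fixes g :: "'b \<Rightarrow> real^'n"
  assumes "p \<in> convex hull (g ` S)"
  obtains a :: "real^('n option)" and z :: "'b^('n option)"
    where "0 \<le> a" "(\<Sum>s\<in>UNIV. a $ s) = 1" "\<And>s. z $ s \<in> S" "(\<Sum>s\<in>UNIV. a $ s *\<^sub>R g (z $ s)) = p"
proof -
  obtain T u where T: "finite T" "T \<subseteq> g ` S" "card T \<le> DIM(real^'n) + 1"
    and u: "\<forall>v\<in>T. 0 \<le> u v" "sum u T = 1" "(\<Sum>v\<in>T. u v *\<^sub>R v) = p"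
    using assms unfolding convex_hull_caratheodory mem_Collect_eq by (elim exE conjE)
  have "card T \<le> card (UNIV :: 'n option set)" using T(3) by (simp add: UNIV_option_conv card_image)
  then obtain h where h: "inj_on h T" "h ` T \<subseteq> (UNIV :: 'n option set)"
    using card_le_inj[OF T(1) finite] by blast
  have "T \<noteq> {}" using u(2) by auto
  then obtain y0 where y0: "y0 \<in> S" using T(2) by blast
  have "\<forall>v\<in>T. \<exists>y\<in>S. g y = v" using T(2) by blast
  then obtain \<pi> where \<pi>: "\<And>v. v \<in> T \<Longrightarrow> \<pi> v \<in> S" "\<And>v. v \<in> T \<Longrightarrow> g (\<pi> v) = v" by metis
  define k where "k = the_inv_into T h"
  have k: "k (h v) = v" if "v \<in> T" for v using h(1) that by (simp add: k_def the_inv_into_f_f)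
  define a :: "real^('n option)" where "a = (\<chi> s. if s \<in> h ` T then u (k s) else 0)"
  define z :: "'b^('n option)" where "z = (\<chi> s. if s \<in> h ` T then \<pi> (k s) else y0)"
  show thesis
  proof
    show "0 \<le> a" using u(1) k by (auto simp: a_def less_eq_vec_def)
    have "(\<Sum>s\<in>UNIV. a $ s) = (\<Sum>s\<in>h ` T. a $ s)"
      by (rule sum.mono_neutral_right) (auto simp: a_def)
    also have "\<dots> = sum u T"
      using k by (simp add: sum.reindex[OF h(1)] a_def)
    finally show "(\<Sum>s\<in>UNIV. a $ s) = 1" using u(2) by simp
    show "z $ s \<in> S" for s using \<pi>(1) y0 k by (auto simp: z_def)
    have "(\<Sum>s\<in>UNIV. a $ s *\<^sub>R g (z $ s)) = (\<Sum>s\<in>h ` T. a $ s *\<^sub>R g (z $ s))"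
      by (rule sum.mono_neutral_right) (auto simp: a_def)
    also have "\<dots> = (\<Sum>v\<in>T. u v *\<^sub>R v)"
      using k \<pi>(2) by (simp add: sum.reindex[OF h(1)] a_def z_def)
    finally show "(\<Sum>s\<in>UNIV. a $ s *\<^sub>R g (z $ s)) = p" using u(3) by simp
  qed
qed

section \<open>Second derivatives in coordinates\<close>

lemma linear_expansion:
  fixes L :: "real^'n \<Rightarrow> 'b::real_vector"
  assumes "linear L"
  shows "L h = (\<Sum>j\<in>UNIV. h $ j *\<^sub>R L (axis j 1))"
proof -
  have "L h = L (\<Sum>j\<in>UNIV. h $ j *\<^sub>R axis j 1)"
    using basis_expansion[of h] by (simp add: scalar_mult_eq_scaleR)
  also have "\<dots> = (\<Sum>j\<in>UNIV. h $ j *\<^sub>R L (axis j 1))"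
    by (simp add: linear_sum[OF assms] linear_cmul[OF assms])
  finally show ?thesis .
qed

lemma partial_derivative_eq:
  assumes "(h has_derivative h') (at u)"
  shows "partial_derivative i h u = h' (axis i 1)"
proof -
  have "((\<lambda>t. u + t *\<^sub>R axis i 1) has_derivative (\<lambda>t. t *\<^sub>R axis i 1)) (at (0::real))"
    by (auto intro!: derivative_eq_intros)
  from has_derivative_compose[OF this, of h h'] assms
  have "((\<lambda>t. h (u + t *\<^sub>R axis i 1)) has_derivative (\<lambda>t. h' (t *\<^sub>R axis i 1))) (at 0)" by simp
  moreover have "h' (t *\<^sub>R axis i 1) = h' (axis i 1) * t" for t
    using linear_cmul[OF has_derivative_linear[OF assms]] by simp
  ultimately have "((\<lambda>t. h (u + t *\<^sub>R axis i 1)) has_real_derivative h' (axis i 1)) (at 0)"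
    by (simp add: has_field_derivative_def)
  then show ?thesis unfolding partial_derivative_def by (rule DERIV_imp_deriv)
qed

lemma has_derivative_vec_lambda:
  fixes f :: "'a::real_normed_vector \<Rightarrow> 'n::finite \<Rightarrow> real"
  assumes "\<And>j. ((\<lambda>w. f w j) has_derivative (\<lambda>h. f' h j)) (at w)"
  shows "((\<lambda>w. \<chi> j. f w j) has_derivative (\<lambda>h. \<chi> j. f' h j)) (at w)"
  using assms
  by (intro has_derivative_componentwise_within[THEN iffD2]) (auto simp: Basis_vec_def inner_axis)

lemma bounded_linear_Pair_left: "bounded_linear (\<lambda>h. (h, 0))"
  and bounded_linear_Pair_right: "bounded_linear (\<lambda>h. (0, h))"
  by (simp_all add: bounded_linear_Pair bounded_linear_ident bounded_linear_zero)

lemma continuous_on_vec_lambda_real: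
  assumes "\<And>i. continuous_on T (\<lambda>w. f w i :: 'b::real_normed_vector)"
  shows "continuous_on T (\<lambda>w. \<chi> i. f w i)"
  using assms unfolding continuous_on_def by (auto intro!: tendsto_vec_lambda)

context
  fixes f :: "(real^'n) \<times> (real^'m) \<Rightarrow> real"
    and f' :: "(real^'n) \<times> (real^'m) \<Rightarrow> (((real^'n) \<times> (real^'m)) \<Rightarrow>\<^sub>L real)"
    and f'' :: "(real^'n) \<times> (real^'m) \<Rightarrow> (((real^'n) \<times> (real^'m)) \<Rightarrow>\<^sub>L (((real^'n) \<times> (real^'m)) \<Rightarrow>\<^sub>L real))"
  assumes d1: "\<And>u. (f has_derivative blinfun_apply (f' u)) (at u)"
    and d2: "\<And>u. (f' has_derivative blinfun_apply (f'' u)) (at u)"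
    and d2_cont: "continuous_on UNIV f''"
begin

lemma f_der_x: "((\<lambda>u. f (u, y)) has_derivative (\<lambda>h. f' (u, y) (h, 0))) (at u)"
  by (rule has_derivative_compose[OF has_derivative_Pair[OF has_derivative_ident has_derivative_const] d1])

lemma grad_x_nth: "grad_x f u y $ j = f' (u, y) (axis j 1, 0)"
  by (simp add: grad_x_def partial_derivative_eq[OF f_der_x])

lemma f_der_grad_x: "((\<lambda>u. f (u, y)) has_derivative (\<lambda>h. grad_x f u y \<bullet> h)) (at u)"
proof -
  have lin: "linear (\<lambda>h. f' (u, y) (h, 0))" using f_der_x by (rule has_derivative_linear)
  have "f' (u, y) (h, 0) = grad_x f u y \<bullet> h" for h
    by (subst linear_expansion[OF lin]) (simp add: inner_vec_def grad_x_nth mult.commute)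
  with f_der_x[of y u] show ?thesis by simp
qed

lemma f'_der: "((\<lambda>w. f' w v) has_derivative (\<lambda>h. f'' w h v)) (at w)"
  by (rule bounded_linear.has_derivative[OF blinfun.bounded_linear_left d2])

lemma hess_xx_nth: "hess_xx f u y $ i $ j = f'' (u, y) (axis i 1, 0) (axis j 1, 0)"
proof -
  have "((\<lambda>u. f' (u, y) (axis j 1, 0)) has_derivative (\<lambda>h. f'' (u, y) (h, 0) (axis j 1, 0))) (at u)"
    by (rule has_derivative_compose[OF has_derivative_Pair[OF has_derivative_ident has_derivative_const] f'_der])
  from partial_derivative_eq[OF this] show ?thesis by (simp add: hess_xx_def grad_x_nth)
qed

lemma hess_xy_nth: "hess_xy f u y $ i $ j = f'' (u, y) (0, axis i 1) (axis j 1, 0)"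
proof -
  have "((\<lambda>y. f' (u, y) (axis j 1, 0)) has_derivative (\<lambda>h. f'' (u, y) (0, h) (axis j 1, 0))) (at y)"
    by (rule has_derivative_compose[OF has_derivative_Pair[OF has_derivative_const has_derivative_ident] f'_der])
  from partial_derivative_eq[OF this] show ?thesis by (simp add: hess_xy_def grad_x_nth)
qed

definition "grad_x_deriv w h = (\<chi> j. blinfun_apply (blinfun_apply (f'' w) h) (axis j 1, 0))"

lemma grad_x_has_derivative:
  "((\<lambda>w. grad_x f (fst w) (snd w)) has_derivative grad_x_deriv w) (at w)"
proof -
  have "(\<lambda>w. grad_x f (fst w) (snd w)) = (\<lambda>w. \<chi> j. f' w (axis j 1, 0))"
    by (simp add: vec_eq_iff grad_x_nth fun_eq_iff)
  then show ?thesis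
    unfolding grad_x_deriv_def[abs_def] by (simp only:) (intro has_derivative_vec_lambda f'_der)
qed

text \<open>This computes the adjoint of the derivative of \<open>grad_x\<close>. In both Hessian
  matrices the column is the component of \<open>grad_x\<close> and the row the direction of
  differentiation, so they apply to \<open>v\<close> without a transpose.\<close>

lemma inner_grad_x_deriv:
  "v \<bullet> grad_x_deriv (u, y) (h, k) = h \<bullet> (hess_xx f u y *v v) + k \<bullet> (hess_xy f u y *v v)"
proof -
  have lin: "linear (\<lambda>h. f'' (u, y) (h, 0) w)" "linear (\<lambda>k. f'' (u, y) (0, k) w)" for w
    by (intro bounded_linear.linear bounded_linear_compose[OF
          bounded_linear_compose[OF blinfun.bounded_linear_left blinfun.bounded_linear_right]]
        bounded_linear_Pair_left bounded_linear_Pair_right)+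
  have split: "f'' (u, y) (h, k) w = f'' (u, y) (h, 0) w + f'' (u, y) (0, k) w" for w
    by (simp flip: blinfun.add_left blinfun.add_right)
  have 1: "(\<Sum>j\<in>UNIV. v $ j * f'' (u, y) (h, 0) (axis j 1, 0)) = h \<bullet> (hess_xx f u y *v v)"
    by (subst linear_expansion[OF lin(1)])
      (simp add: inner_vec_def matrix_vector_mult_def hess_xx_nth sum_distrib_left,
        subst sum.swap, simp add: mult_ac)
  have 2: "(\<Sum>j\<in>UNIV. v $ j * f'' (u, y) (0, k) (axis j 1, 0)) = k \<bullet> (hess_xy f u y *v v)"
    by (subst linear_expansion[OF lin(2)])
      (simp add: inner_vec_def matrix_vector_mult_def hess_xy_nth sum_distrib_left,
        subst sum.swap, simp add: mult_ac)
  have "v \<bullet> grad_x_deriv (u, y) (h, k) =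
      (\<Sum>j\<in>UNIV. v $ j * f'' (u, y) (h, 0) (axis j 1, 0)) +
      (\<Sum>j\<in>UNIV. v $ j * f'' (u, y) (0, k) (axis j 1, 0))"
    unfolding grad_x_deriv_def inner_vec_def
    by (subst split) (simp add: distrib_left sum.distrib)
  then show ?thesis by (simp only: 1 2)
qed

lemma continuous_f'': "continuous_on UNIV (\<lambda>w. blinfun_apply (blinfun_apply (f'' w) a) b)"
  by (intro bounded_linear.continuous_on[OF blinfun.bounded_linear_left] d2_cont)

lemma continuous_hess_xx: "continuous_on UNIV (\<lambda>w. hess_xx f (fst w) (snd w))"
proof -
  have "(\<lambda>w. hess_xx f (fst w) (snd w)) =
      (\<lambda>w. \<chi> i. \<chi> j. f'' w (axis i 1, 0) (axis j 1, 0))"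
    by (simp add: vec_eq_iff hess_xx_nth fun_eq_iff)
  then show ?thesis by (simp only:) (intro continuous_on_vec_lambda_real continuous_f'')
qed

lemma continuous_hess_xy: "continuous_on UNIV (\<lambda>w. hess_xy f (fst w) (snd w))"
proof -
  have "(\<lambda>w. hess_xy f (fst w) (snd w)) =
      (\<lambda>w. \<chi> i. \<chi> j. f'' w (0, axis i 1) (axis j 1, 0))"
    by (simp add: vec_eq_iff hess_xy_nth fun_eq_iff)
  then show ?thesis by (simp only:) (intro continuous_on_vec_lambda_real continuous_f'')
qed

end

lemma tendsto_matrix_vector_mult:
  fixes A :: "'a \<Rightarrow> real^'n^'m"
  assumes "(A \<longlongrightarrow> A0) F" "(v \<longlongrightarrow> v0) F"
  shows "((\<lambda>k. A k *v v k) \<longlongrightarrow> A0 *v v0) F"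
  unfolding matrix_vector_mult_def
  by (intro tendsto_vec_lambda tendsto_sum tendsto_mult tendsto_vec_nth assms)

section \<open>The second-order subdifferential of the optimal value function\<close>

context
  fixes f :: "(real^'n) \<times> (real^'m) \<Rightarrow> real" and g :: "real^'m \<Rightarrow> real^'p"
  assumes f_C2: "twice_continuously_differentiable f"
    and solvable: "\<And>u. solution_map f g u \<noteq> {}"
    and compact_feasible: "compact (feasible_set g)"
begin

section \<open>Solutions, optimal values and gradients of the parametric problem\<close>

lemma solution_map_iff:
  "y \<in> solution_map f g u \<longleftrightarrow>
    y \<in> feasible_set g \<and> (\<forall>w\<in>feasible_set g. f (u, y) \<le> f (u, w))"
  by (auto simp: solution_map_def is_arg_min_def not_less)

lemma solution_map_subset: "solution_map f g u \<subseteq> feasible_set g"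
  by (auto simp: solution_map_iff)

lemma optimal_value_eq:
  assumes "y \<in> solution_map f g u"
  shows "optimal_value f g u = f (u, y)"
  unfolding optimal_value_def using assms
  by (intro cInf_eq_minimum) (auto simp: solution_map_iff)

lemma optimal_value_le:
  assumes "y \<in> feasible_set g"
  shows "optimal_value f g u \<le> f (u, y)"
proof -
  obtain y0 where "y0 \<in> solution_map f g u" using solvable by blast
  then show ?thesis using assms optimal_value_eq by (auto simp: solution_map_iff)
qed

lemma continuous_f: "continuous_on UNIV f"
proof -
  obtain f' :: "(real^'n) \<times> (real^'m) \<Rightarrow> (((real^'n) \<times> (real^'m)) \<Rightarrow>\<^sub>L real)"
    where "\<forall>u. (f has_derivative blinfun_apply (f' u)) (at u)"
    using f_C2 unfolding twice_continuously_differentiable_def by blast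
  then show ?thesis by (intro has_derivative_continuous_on) auto
qed

text \<open>Optimality is an intersection of closed conditions, one for each feasible competitor
  \<open>w\<close>.\<close>

lemma closed_graph_solution_map: "closed (graph_of (solution_map f g))"
proof -
  have "graph_of (solution_map f g) = snd -` feasible_set g \<inter>
      (\<Inter>w\<in>feasible_set g. {v. f v \<le> f (fst v, w)})"
    by (auto simp: graph_of_def solution_map_iff)
  moreover have "closed {v. f v \<le> f (fst v, w)}" for w
    by (intro closed_Collect_le continuous_f continuous_on_compose2[OF continuous_f]
        continuous_on_Pair continuous_on_fst continuous_on_const continuous_on_id) auto
  moreover have "closed (snd -` feasible_set g :: ((real^'n) \<times> (real^'m)) set)"
    by (intro closed_vimage compact_imp_closed compact_feasible continuous_on_snd continuous_on_id)
  ultimately show ?thesis by (simp only:) (intro closed_Int closed_INT ballI)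
qed

text \<open>The derivatives hidden in \<open>twice_continuously_differentiable\<close> are fixed
  once, so that what follows refers only to \<open>grad_x\<close>, \<open>hess_xx\<close> and
  \<open>hess_xy\<close>.\<close>

lemma f_derivatives:
  shows f_grad_x: "\<And>u y. ((\<lambda>u. f (u, y)) has_derivative (\<lambda>h. grad_x f u y \<bullet> h)) (at u)"
    and grad_x_derivative: "\<exists>D. \<forall>u y. ((\<lambda>w. grad_x f (fst w) (snd w)) has_derivative D (u, y)) (at (u, y)) \<and>
      (\<forall>v h k. v \<bullet> D (u, y) (h, k) = h \<bullet> (hess_xx f u y *v v) + k \<bullet> (hess_xy f u y *v v))"
    and cont_hess_xx: "continuous_on UNIV (\<lambda>w. hess_xx f (fst w) (snd w))"
    and cont_hess_xy: "continuous_on UNIV (\<lambda>w. hess_xy f (fst w) (snd w))"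
proof -
  obtain f' f'' where d: "\<And>u. (f has_derivative blinfun_apply (f' u)) (at u)"
      "\<And>u. (f' has_derivative blinfun_apply (f'' u)) (at u)" "continuous_on UNIV f''"
    using f_C2 unfolding twice_continuously_differentiable_def by blast
  show "((\<lambda>u. f (u, y)) has_derivative (\<lambda>h. grad_x f u y \<bullet> h)) (at u)" for u y
    by (rule f_der_grad_x[OF d])
  show "\<exists>D. \<forall>u y. ((\<lambda>w. grad_x f (fst w) (snd w)) has_derivative D (u, y)) (at (u, y)) \<and>
      (\<forall>v h k. v \<bullet> D (u, y) (h, k) = h \<bullet> (hess_xx f u y *v v) + k \<bullet> (hess_xy f u y *v v))"
    by (intro exI[of _ "grad_x_deriv f''"] allI conjI grad_x_has_derivative[OF d]
        inner_grad_x_deriv[OF d])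
  show "continuous_on UNIV (\<lambda>w. hess_xx f (fst w) (snd w))" by (rule continuous_hess_xx[OF d])
  show "continuous_on UNIV (\<lambda>w. hess_xy f (fst w) (snd w))" by (rule continuous_hess_xy[OF d])
qed

lemma cont_grad_x: "continuous_on UNIV (\<lambda>w. grad_x f (fst w) (snd w))"
proof -
  obtain D where "\<And>u y. ((\<lambda>w. grad_x f (fst w) (snd w)) has_derivative D (u, y)) (at (u, y))"
    using grad_x_derivative by blast
  then have "((\<lambda>w. grad_x f (fst w) (snd w)) has_derivative D w) (at w)" for w
    by (cases w) simp
  then show ?thesis by (rule has_derivative_continuous_on)
qed

text \<open>This form matches the abstract gradient \<open>F\<close> applied to a pair, as Danskin's
  formula requires it.\<close>

lemma f_grad_x': "((\<lambda>u. f (u, y)) has_derivative (\<lambda>h. grad_x f (fst (u, y)) (snd (u, y)) \<bullet> h)) (at u)"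
  using f_grad_x by simp

lemmas danskin = compact_feasible cont_grad_x f_grad_x' closed_graph_solution_map solvable
  solution_map_subset optimal_value_eq optimal_value_le

text \<open>Forwards, Danskin's formula and Caratheodory's theorem supply weights and solutions;
  backwards, each gradient is a subgradient and the subdifferential is convex. The backward
  direction makes the pullback map land in the graph of the subdifferential.\<close>

lemma clarke_subdifferential_optimal_value_iff:
  "p \<in> clarke_subdifferential (optimal_value f g) u \<longleftrightarrow> (\<exists>a z. (a, z) \<in> Gamma_circ f g u p)"
proof
  assume "p \<in> clarke_subdifferential (optimal_value f g) u"
  then have "p \<in> convex hull ((\<lambda>y. grad_x f u y) ` solution_map f g u)"
    using clarke_subdifferential_subset[OF danskin] by auto
  then obtain a :: "real^('n option)" and z :: "(real^'m)^('n option)"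
    where "0 \<le> a" "(\<Sum>s\<in>UNIV. a $ s) = 1" "\<And>s. z $ s \<in> solution_map f g u"
      "(\<Sum>s\<in>UNIV. a $ s *\<^sub>R grad_x f u (z $ s)) = p"
    by (rule convex_hull_image_indexed) blast
  then show "\<exists>a z. (a, z) \<in> Gamma_circ f g u p" by (auto simp: Gamma_circ_def)
next
  assume "\<exists>a z. (a, z) \<in> Gamma_circ f g u p"
  then obtain a z where "(a, z) \<in> Gamma_circ f g u p" by blast
  then have az: "0 \<le> a" "(\<Sum>s\<in>UNIV. a $ s) = 1"
    "(\<Sum>s\<in>UNIV. a $ s *\<^sub>R grad_x f u (z $ s)) = p" "\<And>s. z $ s \<in> solution_map f g u"
    by (simp_all add: Gamma_circ_def)
  have "(\<Sum>s\<in>UNIV. a $ s *\<^sub>R grad_x f u (z $ s)) \<in> clarke_subdifferential (optimal_value f g) u"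
  proof (rule convex_sum[OF _ convex_clarke_subdifferential az(2)])
    show "0 \<le> a $ s" for s using az(1) by (simp add: less_eq_vec_def)
    show "grad_x f u (z $ s) \<in> clarke_subdifferential (optimal_value f g) u" for s
      using gradient_in_clarke_subdifferential[OF danskin az(4)] by simp
  qed simp
  then show "p \<in> clarke_subdifferential (optimal_value f g) u" using az(3) by simp
qed

text \<open>With the convex weights \<open>a\<close> frozen, \<open>(u, y) \<mapsto> (u, \<Sum>\<^sub>s a\<^sub>s \<nabla>\<^sub>xf(u, y\<^sub>s))\<close> maps the fibre power of
  the graph of the solution map into the graph of \<open>\<partial>\<phi>\<close>; this is the pullback along that map.\<close>

lemma regular_normal_pullback_to_solutions:
  assumes az: "(a, z) \<in> Gamma_circ f g u p"
    and vw: "(v, w) \<in> regular_normal_cone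
      (graph_of (clarke_subdifferential (optimal_value f g))) (u, p)"
  shows "(v + (\<Sum>s\<in>UNIV. a $ s *\<^sub>R (hess_xx f u (z $ s) *v w)),
      \<chi> s. a $ s *\<^sub>R (hess_xy f u (z $ s) *v w))
    \<in> regular_normal_cone (fibre_power (graph_of (solution_map f g))) (u, z)"
proof -
  obtain D where D: "\<And>u y. ((\<lambda>w. grad_x f (fst w) (snd w)) has_derivative D (u, y)) (at (u, y))"
    and inner_D: "\<And>u y v h k. v \<bullet> D (u, y) (h, k) =
      h \<bullet> (hess_xx f u y *v v) + k \<bullet> (hess_xy f u y *v v)"
    using grad_x_derivative by blast
  define G where "G r = (fst r, \<Sum>s\<in>UNIV. a $ s *\<^sub>R grad_x f (fst r) (snd r $ s))"
    for r :: "(real^'n) \<times> ((real^'m)^('n option))"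
  define G' where "G' r = (fst r, \<Sum>s\<in>UNIV. a $ s *\<^sub>R D (u, z $ s) (fst r, snd r $ s))"
    for r :: "(real^'n) \<times> ((real^'m)^('n option))"
  have a: "0 \<le> a" "(\<Sum>s\<in>UNIV. a $ s) = 1" "(\<Sum>s\<in>UNIV. a $ s *\<^sub>R grad_x f u (z $ s)) = p"
    using az by (auto simp: Gamma_circ_def)
  show ?thesis
  proof (rule regular_normal_cone_pullback)
    show "(v, w) \<in> regular_normal_cone (graph_of (clarke_subdifferential (optimal_value f g)))
        (G (u, z))"
      using vw a(3) by (simp add: G_def)
    show "G ` fibre_power (graph_of (solution_map f g))
        \<subseteq> graph_of (clarke_subdifferential (optimal_value f g))"
    proof (rule image_subsetI)
      fix r :: "(real^'n) \<times> ((real^'m)^('n option))"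
      assume "r \<in> fibre_power (graph_of (solution_map f g))"
      then have "\<forall>s. snd r $ s \<in> solution_map f g (fst r)"
        by (auto simp: fibre_power_def graph_of_def)
      then have "(a, snd r) \<in> Gamma_circ f g (fst r) (snd (G r))"
        using a(1,2) by (simp add: Gamma_circ_def G_def)
      then have "snd (G r) \<in> clarke_subdifferential (optimal_value f g) (fst r)"
        unfolding clarke_subdifferential_optimal_value_iff by blast
      then show "G r \<in> graph_of (clarke_subdifferential (optimal_value f g))"
        by (simp add: graph_of_def G_def)
    qed
    have lin: "bounded_linear (\<lambda>r :: (real^'n) \<times> ((real^'m)^('n option)). (fst r, snd r $ s))" for s
      by (intro bounded_linear_Pair bounded_linear_fst
          bounded_linear_compose[OF bounded_linear_vec_nth bounded_linear_snd])
    have comp: "((\<lambda>r. grad_x f (fst r) (snd r $ s)) has_derivative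
        (\<lambda>r. D (u, z $ s) (fst r, snd r $ s))) (at (u, z))" for s
    proof -
      have "((\<lambda>w. grad_x f (fst w) (snd w)) has_derivative D (u, z $ s))
          (at (fst (u, z), snd (u, z) $ s))"
        using D by simp
      from has_derivative_compose[OF bounded_linear_imp_has_derivative[OF lin] this]
      show ?thesis by simp
    qed
    show "(G has_derivative G') (at (u, z))"
      unfolding G_def[abs_def] G'_def[abs_def]
      by (intro has_derivative_Pair has_derivative_fst has_derivative_ident has_derivative_sum
          has_derivative_scaleR_right comp)
    \<comment> \<open>The adjoint of \<open>G'\<close>: by \<open>inner_D\<close> every index adds
      its \<open>hess_xx\<close> term to the common first component and its \<open>hess_xy\<close>
      term to its own component.\<close>
    show "(v + (\<Sum>s\<in>UNIV. a $ s *\<^sub>R (hess_xx f u (z $ s) *v w)),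
        \<chi> s. a $ s *\<^sub>R (hess_xy f u (z $ s) *v w)) \<bullet> r = (v, w) \<bullet> G' r" for r
    proof (cases r)
      case (Pair h k)
      have "(\<chi> s. a $ s *\<^sub>R (hess_xy f u (z $ s) *v w)) \<bullet> k =
          (\<Sum>s\<in>UNIV. a $ s * (k $ s \<bullet> (hess_xy f u (z $ s) *v w)))"
        by (subst inner_vec_def) (simp add: inner_commute)
      then show ?thesis
        by (simp add: Pair G'_def inner_add_left inner_sum_left inner_sum_right inner_D
            distrib_left sum.distrib inner_commute[of _ h] inner_add_right)
    qed
  qed
qed

text \<open>The simplex conditions are closed, continuity of \<open>grad_x\<close> preserves the
  representation of the subgradient, and the closed graph of the solution map keeps the limits
  optimal.\<close>

lemma Gamma_circ_limit:
  assumes "X \<longlonglongrightarrow> u" "P \<longlonglongrightarrow> p" "A \<longlonglongrightarrow> a" "Z \<longlonglongrightarrow> z"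
    and mem: "\<And>k. (A k, Z k) \<in> Gamma_circ f g (X k) (P k)"
  shows "(a, z) \<in> Gamma_circ f g u p"
proof -
  have A0: "0 \<le> A k $ s" and A1: "(\<Sum>s\<in>UNIV. A k $ s) = 1"
    and AP: "(\<Sum>s\<in>UNIV. A k $ s *\<^sub>R grad_x f (X k) (Z k $ s)) = P k"
    and ZS: "(X k, Z k $ s) \<in> graph_of (solution_map f g)" for k s
    using mem[of k] by (auto simp: Gamma_circ_def less_eq_vec_def graph_of_def)
  have XZ: "(\<lambda>k. (X k, Z k $ s)) \<longlonglongrightarrow> (u, z $ s)" for s
    by (intro tendsto_Pair tendsto_vec_nth assms)
  have "0 \<le> a $ s" for s
    by (rule LIMSEQ_le_const[OF tendsto_vec_nth[OF assms(3)]]) (use A0 in blast)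
  moreover have "(\<Sum>s\<in>UNIV. a $ s) = 1"
  proof (rule LIMSEQ_unique)
    show "(\<lambda>k. \<Sum>s\<in>UNIV. A k $ s) \<longlonglongrightarrow> (\<Sum>s\<in>UNIV. a $ s)"
      by (intro tendsto_sum tendsto_vec_nth assms)
    show "(\<lambda>k. \<Sum>s\<in>UNIV. A k $ s) \<longlonglongrightarrow> 1" by (simp add: A1)
  qed
  moreover have "(\<Sum>s\<in>UNIV. a $ s *\<^sub>R grad_x f u (z $ s)) = p"
  proof (rule LIMSEQ_unique)
    have "(\<lambda>k. grad_x f (X k) (Z k $ s)) \<longlonglongrightarrow> grad_x f u (z $ s)" for s
      using continuous_on_tendsto_compose[OF cont_grad_x XZ] by simp
    then show "(\<lambda>k. \<Sum>s\<in>UNIV. A k $ s *\<^sub>R grad_x f (X k) (Z k $ s)) \<longlonglongrightarrow>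
        (\<Sum>s\<in>UNIV. a $ s *\<^sub>R grad_x f u (z $ s))"
      by (intro tendsto_sum tendsto_scaleR tendsto_vec_nth assms)
    show "(\<lambda>k. \<Sum>s\<in>UNIV. A k $ s *\<^sub>R grad_x f (X k) (Z k $ s)) \<longlonglongrightarrow> p"
      unfolding AP by (rule assms(2))
  qed
  moreover have "z $ s \<in> solution_map f g u" for s
    using closed_sequentially[OF closed_graph_solution_map ZS XZ] by (simp add: graph_of_def)
  ultimately show ?thesis by (simp add: Gamma_circ_def less_eq_vec_def)
qed

text \<open>Weights in the simplex and solutions in the compact feasible set give a bound uniform in
  \<open>u\<close> and \<open>p\<close>, which allows convergent subsequences to be
  extracted.\<close>

lemma Gamma_circ_bounded:
  obtains B where "\<And>u p a z. (a, z) \<in> Gamma_circ f g u p \<Longrightarrow> (a, z) \<in> cbox 0 (\<chi> s. 1) \<times> cball 0 B"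
proof -
  obtain b where b: "\<And>y. y \<in> feasible_set g \<Longrightarrow> norm y \<le> b"
    using compact_imp_bounded[OF compact_feasible] unfolding bounded_iff by blast
  show thesis
  proof
    fix u p and a :: "real^('n option)" and z :: "(real^'m)^('n option)"
    assume "(a, z) \<in> Gamma_circ f g u p"
    then have a0: "\<And>s. 0 \<le> a $ s" and a1: "(\<Sum>s\<in>UNIV. a $ s) = 1"
      and z: "\<And>s. z $ s \<in> feasible_set g"
      using solution_map_subset by (auto simp: Gamma_circ_def less_eq_vec_def)
    have "a $ s \<le> 1" for s
      using member_le_sum[of s UNIV "\<lambda>s. a $ s"] a0 a1 by simp
    moreover have "norm z \<le> (\<Sum>s\<in>(UNIV :: 'n option set). b)"
    proof -
      have "norm z \<le> (\<Sum>s\<in>UNIV. norm (z $ s))"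
        unfolding norm_vec_def by (rule L2_set_le_sum) simp
      also have "\<dots> \<le> (\<Sum>s\<in>(UNIV :: 'n option set). b)" by (intro sum_mono b z)
      finally show ?thesis .
    qed
    ultimately show "(a, z) \<in> cbox 0 (\<chi> s. 1) \<times> cball 0 (\<Sum>s\<in>(UNIV :: 'n option set). b)"
      using a0 by (simp add: mem_box_cart)
  qed
qed

text \<open>Regular normals at nearby points of the graph are pulled back first and the limit is
  taken afterwards, with the Hessians converging by continuity. The vector \<open>- xs\<close> comes
  from the sign convention of the coderivative.\<close>

lemma second_subdifferential_normal:
  assumes us: "us \<in> second_subdifferential (optimal_value f g) x xl xs"
  obtains a z where "(a, z) \<in> Gamma_circ f g x xl"
    "(us + (\<Sum>s\<in>UNIV. a $ s *\<^sub>R (hess_xx f x (z $ s) *v (- xs))),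
      \<chi> s. a $ s *\<^sub>R (hess_xy f x (z $ s) *v (- xs)))
      \<in> limiting_normal_cone (fibre_power (graph_of (solution_map f g))) (x, z)"
proof -
  let ?C = "graph_of (clarke_subdifferential (optimal_value f g))"
  have "(us, - xs) \<in> limiting_normal_cone ?C (x, xl)"
    using us by (simp add: second_subdifferential_def coderivative_def)
  then obtain VW XP where VW: "VW \<longlonglongrightarrow> (us, - xs)" and XP: "XP \<longlonglongrightarrow> (x, xl)"
    and XP_mem: "\<And>k. XP k \<in> ?C" and VW_mem: "\<And>k. VW k \<in> regular_normal_cone ?C (XP k)"
    unfolding limiting_normal_cone_def by blast
  define V W X P where "V = (\<lambda>k. fst (VW k))" and "W = (\<lambda>k. snd (VW k))"
    and "X = (\<lambda>k. fst (XP k))" and "P = (\<lambda>k. snd (XP k))"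
  have V: "V \<longlonglongrightarrow> us" and W: "W \<longlonglongrightarrow> - xs" and X: "X \<longlonglongrightarrow> x" and P: "P \<longlonglongrightarrow> xl"
    using tendsto_fst[OF VW] tendsto_snd[OF VW] tendsto_fst[OF XP] tendsto_snd[OF XP]
    by (simp_all add: V_def W_def X_def P_def)
  have XPk: "(X k, P k) \<in> ?C" and VWk: "(V k, W k) \<in> regular_normal_cone ?C (X k, P k)" for k
    using XP_mem[of k] VW_mem[of k] by (simp_all add: V_def W_def X_def P_def)
  have "\<exists>a z. (a, z) \<in> Gamma_circ f g (X k) (P k)" for k
    using XPk[of k] clarke_subdifferential_optimal_value_iff by (simp add: graph_of_def)
  \<comment> \<open>The decompositions are chosen independently for each \<open>k\<close>; their
    convergence is obtained only along a subsequence, by compactness.\<close>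
  then obtain A Z where AZ: "\<And>k. (A k, Z k) \<in> Gamma_circ f g (X k) (P k)" by metis
  obtain B where B: "\<And>u p (a :: real^('n option)) z. (a, z) \<in> Gamma_circ f g u p \<Longrightarrow>
      (a, z) \<in> cbox 0 (\<chi> s. 1) \<times> cball 0 B"
    using Gamma_circ_bounded by blast
  have AZ_bounded: "\<forall>k. (A k, Z k) \<in> cbox 0 (\<chi> s. 1) \<times> cball 0 B" using B AZ by blast
  have "seq_compact (cbox (0 :: real^('n option)) (\<chi> s. 1) \<times>
      cball (0 :: (real^'m)^('n option)) B)"
    by (intro compact_imp_seq_compact compact_Times compact_cbox compact_cball)
  then obtain l \<sigma> where \<sigma>: "strict_mono (\<sigma> :: nat \<Rightarrow> nat)"
    and l: "((\<lambda>k. (A k, Z k)) \<circ> \<sigma>) \<longlonglongrightarrow> l"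
    using AZ_bounded by (rule seq_compactE)
  obtain a z where l_eq: "l = (a, z)" by (cases l)
  have A': "(\<lambda>k. A (\<sigma> k)) \<longlonglongrightarrow> a" and Z': "(\<lambda>k. Z (\<sigma> k)) \<longlonglongrightarrow> z"
    using tendsto_fst[OF l] tendsto_snd[OF l] by (auto simp: l_eq o_def)
  have V': "(\<lambda>k. V (\<sigma> k)) \<longlonglongrightarrow> us" and W': "(\<lambda>k. W (\<sigma> k)) \<longlonglongrightarrow> - xs"
    and X': "(\<lambda>k. X (\<sigma> k)) \<longlonglongrightarrow> x" and P': "(\<lambda>k. P (\<sigma> k)) \<longlonglongrightarrow> xl"
    using LIMSEQ_subseq_LIMSEQ[OF V \<sigma>] LIMSEQ_subseq_LIMSEQ[OF W \<sigma>]
      LIMSEQ_subseq_LIMSEQ[OF X \<sigma>] LIMSEQ_subseq_LIMSEQ[OF P \<sigma>] by (simp_all add: o_def)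
  have XZ': "(\<lambda>k. (X (\<sigma> k), Z (\<sigma> k) $ s)) \<longlonglongrightarrow> (x, z $ s)" for s
    by (intro tendsto_Pair X' tendsto_vec_nth Z')
  have Hxx: "(\<lambda>k. hess_xx f (X (\<sigma> k)) (Z (\<sigma> k) $ s)) \<longlonglongrightarrow> hess_xx f x (z $ s)"
    and Hxy: "(\<lambda>k. hess_xy f (X (\<sigma> k)) (Z (\<sigma> k) $ s)) \<longlonglongrightarrow> hess_xy f x (z $ s)" for s
    using continuous_on_tendsto_compose[OF cont_hess_xx XZ']
      continuous_on_tendsto_compose[OF cont_hess_xy XZ'] by simp_all
  show thesis
  proof
    show "(a, z) \<in> Gamma_circ f g x xl" by (rule Gamma_circ_limit[OF X' P' A' Z' AZ])
    show "(us + (\<Sum>s\<in>UNIV. a $ s *\<^sub>R (hess_xx f x (z $ s) *v (- xs))),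
        \<chi> s. a $ s *\<^sub>R (hess_xy f x (z $ s) *v (- xs)))
        \<in> limiting_normal_cone (fibre_power (graph_of (solution_map f g))) (x, z)"
    proof (rule limiting_normal_coneI)
      show "(\<lambda>k. (X (\<sigma> k), Z (\<sigma> k))) \<longlonglongrightarrow> (x, z)" by (intro tendsto_Pair X' Z')
      show "(X (\<sigma> k), Z (\<sigma> k)) \<in> fibre_power (graph_of (solution_map f g))" for k
        using AZ[of "\<sigma> k"] by (auto simp: fibre_power_def graph_of_def Gamma_circ_def)
      show "(V (\<sigma> k) + (\<Sum>s\<in>UNIV. A (\<sigma> k) $ s *\<^sub>R (hess_xx f (X (\<sigma> k)) (Z (\<sigma> k) $ s) *v W (\<sigma> k))),
          \<chi> s. A (\<sigma> k) $ s *\<^sub>R (hess_xy f (X (\<sigma> k)) (Z (\<sigma> k) $ s) *v W (\<sigma> k)))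
          \<in> regular_normal_cone (fibre_power (graph_of (solution_map f g))) (X (\<sigma> k), Z (\<sigma> k))" for k
        by (rule regular_normal_pullback_to_solutions[OF AZ VWk])
      show "(\<lambda>k. (V (\<sigma> k) + (\<Sum>s\<in>UNIV. A (\<sigma> k) $ s *\<^sub>R (hess_xx f (X (\<sigma> k)) (Z (\<sigma> k) $ s) *v W (\<sigma> k))),
          \<chi> s. A (\<sigma> k) $ s *\<^sub>R (hess_xy f (X (\<sigma> k)) (Z (\<sigma> k) $ s) *v W (\<sigma> k))))
          \<longlonglongrightarrow> (us + (\<Sum>s\<in>UNIV. a $ s *\<^sub>R (hess_xx f x (z $ s) *v (- xs))),
            \<chi> s. a $ s *\<^sub>R (hess_xy f x (z $ s) *v (- xs)))"
        by (intro tendsto_Pair tendsto_add tendsto_sum tendsto_scaleR tendsto_vec_lambda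
            tendsto_matrix_vector_mult tendsto_vec_nth V' W' A' Hxx Hxy)
    qed
  qed
qed

end

theorem theorem5p3:
  fixes f :: "(real^'n) \<times> (real^'m) \<Rightarrow> real"
    and g :: "real^'m \<Rightarrow> real^'p"
    and x xl :: "real^'n"
  assumes f_C2: "twice_continuously_differentiable f"
    and g_C2: "twice_continuously_differentiable g"
    and solvable: "\<And>u. solution_map f g u \<noteq> {}"
    and compact_feasible: "compact (feasible_set g)"
    and subgradient: "xl \<in> clarke_subdifferential (optimal_value f g) x"
    and qualification:
      "\<And>a z (v :: (real^'n)^('n option)).
         (a, z) \<in> Gamma_circ f g x xl \<Longrightarrow>
         (\<Sum>s\<in>UNIV. v $ s) = 0 \<Longrightarrow>
         (\<And>s. v $ s \<in> (\<Union>y\<in>Delta_circ f g x (z $ s). coderivative (solution_map f g) x y 0)) \<Longrightarrow>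
         (\<forall>s. v $ s = 0)"
  shows "\<forall>xs. second_subdifferential (optimal_value f g) x xl xs \<subseteq>
           (\<Union>(a, z)\<in>Gamma_circ f g x xl.
              \<Sum>s\<in>UNIV. \<Union>y\<in>Delta_circ f g x (z $ s).
                (a $ s *\<^sub>R (hess_xx f x y *v xs)) +o
                coderivative (solution_map f g) x y (a $ s *\<^sub>R (hess_xy f x y *v xs)))"
proof (intro allI subsetI)
  fix xs us
  assume "us \<in> second_subdifferential (optimal_value f g) x xl xs"
  then obtain a z where az: "(a, z) \<in> Gamma_circ f g x xl"
    and normal: "(us + (\<Sum>s\<in>UNIV. a $ s *\<^sub>R (hess_xx f x (z $ s) *v (- xs))),
      \<chi> s. a $ s *\<^sub>R (hess_xy f x (z $ s) *v (- xs)))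
      \<in> limiting_normal_cone (fibre_power (graph_of (solution_map f g))) (x, z)"
    by (rule second_subdifferential_normal[OF f_C2 solvable compact_feasible])
  have z_Delta: "z $ s \<in> Delta_circ f g x (z $ s)" for s
    using az by (simp add: Gamma_circ_def Delta_circ_def)
  have qual: "v = 0" if "(\<Sum>s\<in>UNIV. v $ s) = 0"
    "\<And>s. (v $ s, 0) \<in> limiting_normal_cone (graph_of (solution_map f g)) (x, z $ s)"
    for v :: "(real^'n)^('n option)"
  proof -
    have "\<forall>s. v $ s = 0"
      using that z_Delta by (intro qualification[OF az]) (auto simp: coderivative_def)
    then show "v = 0" by (simp add: vec_eq_iff)
  qed
  obtain v where v_sum: "(\<Sum>s\<in>UNIV. v $ s) =
      us + (\<Sum>s\<in>UNIV. a $ s *\<^sub>R (hess_xx f x (z $ s) *v (- xs)))"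
    and v_normal: "\<And>s. (v $ s, (\<chi> s. a $ s *\<^sub>R (hess_xy f x (z $ s) *v (- xs))) $ s)
      \<in> limiting_normal_cone (graph_of (solution_map f g)) (x, z $ s)"
    using limiting_normal_cone_fibre_power[OF
        closed_graph_solution_map[OF f_C2 solvable compact_feasible] normal qual]
    by blast
  \<comment> \<open>The sign moves the \<open>hess_xx\<close> terms to the other side of
    \<open>v_sum\<close>, and in \<open>v_normal\<close> it is exactly the minus sign in the
    definition of the coderivative.\<close>
  have neg: "A *v (- xs) = - (A *v xs)" for A :: "real^'n^'k"
    by (simp add: matrix_vector_mult_def vec_eq_iff sum_negf)
  have "us = (\<Sum>s\<in>UNIV. a $ s *\<^sub>R (hess_xx f x (z $ s) *v xs) + v $ s)"
    using v_sum by (simp add: neg sum.distrib sum_negf)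
  moreover have "a $ s *\<^sub>R (hess_xx f x (z $ s) *v xs) + v $ s \<in>
      (\<Union>y\<in>Delta_circ f g x (z $ s). (a $ s *\<^sub>R (hess_xx f x y *v xs)) +o
        coderivative (solution_map f g) x y (a $ s *\<^sub>R (hess_xy f x y *v xs)))" for s
  proof (rule UN_I[OF z_Delta set_plus_intro2])
    show "v $ s \<in> coderivative (solution_map f g) x (z $ s) (a $ s *\<^sub>R (hess_xy f x (z $ s) *v xs))"
      using v_normal[of s] by (simp add: coderivative_def neg)
  qed
  \<comment> \<open>A Minkowski sum over a finite index set consists of the sums of selections; here
    the selection is the summand just shown to lie in the union for each \<open>s\<close>.\<close>
  ultimately have "us \<in> (\<Sum>s\<in>UNIV. \<Union>y\<in>Delta_circ f g x (z $ s).
      (a $ s *\<^sub>R (hess_xx f x y *v xs)) +o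
      coderivative (solution_map f g) x y (a $ s *\<^sub>R (hess_xy f x y *v xs)))"
    unfolding set_sum_alt[OF finite] by blast
  then show "us \<in> (\<Union>(a, z)\<in>Gamma_circ f g x xl. \<Sum>s\<in>UNIV. \<Union>y\<in>Delta_circ f g x (z $ s).
      (a $ s *\<^sub>R (hess_xx f x y *v xs)) +o
      coderivative (solution_map f g) x y (a $ s *\<^sub>R (hess_xy f x y *v xs)))"
    using az by blast
qed

end
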